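(* Let $n\ge 2$ be an integer. The identity map is the unique order-preserving automorphism of the poset $\mathrm{Poset}(\mathrm{PF}_{n,n})$.
   Context: An order-preserving automorphism of a poset is a bijection $f$ from the poset to itself with $x\le y$ if and only if $f(x)\le f(y)$. Write $[n]=\{1,\dots,n\}$. A parking function of length $n$ is an $n$-tuple $(a_1,\dots,a_n)$ of positive integers whose weakly increasing rearrangement $b_1\le\dots\le b_n$ satisfies $b_i\le i$ for all $i$; $\mathrm{PF}_n$ is the set of these. For $n\ge 2$, $\mathrm{PF}_{n,n}$ is the set of $a\in\mathrm{PF}_n$ such that $n$ is not an entry of $a$. $\mathrm{NC}_m$ is the lattice of noncrossing partitions of $[m]$ (partitions for which, placing $1,\dots,m$ in clockwise order on a circle, the convex hulls of the blocks are pairwise disjoint), ordered by refinement, with the finer partition being smaller. Each covering relation $\sigma<\tau$ in $\mathrm{NC}_{n+1}$ merges two blocks $B_1,B_2$ of $\sigma$ into one block $B=B_1\cup B_2$ of $\tau$; name them so that $\min B\in B_1$, and label the covering relation by the largest element of $B_1$ that is less than every element of $B_2$. Reading the labels of a maximal chain of $\mathrm{NC}_{n+1}$ from bottom to top gives a parking function of length $n$, and this is a (known) bijection from maximal chains of $\mathrm{NC}_{n+1}$ to $\mathrm{PF}_n$. $\mathrm{Poset}(\mathrm{PF}_{n,n})$ is the poset whose Hasse diagram is the union of the maximal chains of $\mathrm{NC}_{n+1}$ corresponding to elements of $\mathrm{PF}_{n,n}$: its elements are the noncrossing partitions lying on at least one of these chains, and its order is the reflexive-transitive closure of the covering relations occurring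 in these chains (it need not be an induced subposet of $\mathrm{NC}_{n+1}$). *)

theory Defs
  imports "HOL-Analysis.Analysis"
begin

definition parking_functions :: "nat \<Rightarrow> nat list set" where
  "parking_functions n =
     {a. length a = n \<and> (\<forall>x\<in>set a. 1 \<le> x) \<and> (\<forall>i\<in>{1..n}. sort a ! (i - 1) \<le> i)}"

definition parking_functions_avoiding_max :: "nat \<Rightarrow> nat list set" where
  "parking_functions_avoiding_max n = {a \<in> parking_functions n. n \<notin> set a}"

text \<open>
  The numbers \<open>1, \<dots>, m\<close> are placed clockwise at the \<open>m\<close>-th roots of unity in the complex plane.
\<close>

definition circle_point :: "nat \<Rightarrow> nat \<Rightarrow> complex" where
  "circle_point m k = cis (- (2 * pi * real k / real m))"

definition NC :: "nat \<Rightarrow> nat set set set" where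
  "NC m = {P. partition_on {1..m} P \<and>
     pairwise (\<lambda>B C. disjnt (convex hull (circle_point m ` B)) (convex hull (circle_point m ` C))) P}"

definition nc_less :: "nat \<Rightarrow> nat set set \<Rightarrow> nat set set \<Rightarrow> bool" where
  "nc_less m P Q \<longleftrightarrow> P \<in> NC m \<and> Q \<in> NC m \<and> refines {1..m} P Q \<and> P \<noteq> Q"

text \<open>
  A maximal chain is represented by the list of its elements, read from bottom to top.
\<close>

definition nc_max_chains :: "nat \<Rightarrow> nat set set list set" where
  "nc_max_chains m =
     {c. sorted_wrt (nc_less m) c \<and> pred_on.maxchain (NC m) (nc_less m) (set c)}"

text \<open>
  The label is only meaningful if \<open>\<tau>\<close> covers \<open>\<sigma>\<close>; the description below then determines
  \<open>B\<^sub>1\<close> and \<open>B\<^sub>2\<close>, and hence the label, uniquely.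
\<close>

definition cover_label :: "nat set set \<Rightarrow> nat set set \<Rightarrow> nat" where
  "cover_label \<sigma> \<tau> =
     (THE l. \<exists>B\<^sub>1\<in>\<sigma>. \<exists>B\<^sub>2\<in>\<sigma>. B\<^sub>1 \<noteq> B\<^sub>2 \<and> \<tau> = (\<sigma> - {B\<^sub>1, B\<^sub>2}) \<union> {B\<^sub>1 \<union> B\<^sub>2} \<and>
        Min (B\<^sub>1 \<union> B\<^sub>2) \<in> B\<^sub>1 \<and> l = Max {i \<in> B\<^sub>1. \<forall>j\<in>B\<^sub>2. i < j})"

definition chain_labels :: "nat set set list \<Rightarrow> nat list" where
  "chain_labels c = map (\<lambda>i. cover_label (c ! i) (c ! Suc i)) [0..<length c - 1]"

text \<open>
  For a set \<open>S\<close> of parking functions of length \<open>n\<close>, the poset whose Hasse diagram is the union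
  of the maximal chains of \<open>NC (n + 1)\<close> with labels in \<open>S\<close>.
\<close>

definition pf_chains :: "nat \<Rightarrow> nat list set \<Rightarrow> nat set set list set" where
  "pf_chains n S = {c \<in> nc_max_chains (n + 1). chain_labels c \<in> S}"

definition pf_poset_elems :: "nat \<Rightarrow> nat list set \<Rightarrow> nat set set set" where
  "pf_poset_elems n S = (\<Union>c\<in>pf_chains n S. set c)"

definition pf_poset_covers :: "nat \<Rightarrow> nat list set \<Rightarrow> (nat set set) rel" where
  "pf_poset_covers n S = {(c ! i, c ! Suc i) | c i. c \<in> pf_chains n S \<and> Suc i < length c}"

definition pf_poset_le :: "nat \<Rightarrow> nat list set \<Rightarrow> nat set set \<Rightarrow> nat set set \<Rightarrow> bool" where
  "pf_poset_le n S x y \<longleftrightarrow>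
     x \<in> pf_poset_elems n S \<and> y \<in> pf_poset_elems n S \<and> (x, y) \<in> (pf_poset_covers n S)\<^sup>*"

definition order_automorphism :: "'a set \<Rightarrow> ('a \<Rightarrow> 'a \<Rightarrow> bool) \<Rightarrow> ('a \<Rightarrow> 'a) \<Rightarrow> bool" where
  "order_automorphism A le f \<longleftrightarrow>
     bij_betw f A A \<and> (\<forall>x\<in>A. \<forall>y\<in>A. le x y \<longleftrightarrow> le (f x) (f y))"

end

theory Submission
  imports Defs
begin

text \<open>
  A cover in \<open>NC (n + 1)\<close> has label \<open>n\<close> iff it merges the block \<open>{n + 1}\<close> into the block of \<open>n\<close>.
  Call the other covers good; the order of the poset is reachability along good covers. The atoms
  are the pairs \<open>{i, j}\<close> other than \<open>{1, n}\<close> and \<open>{n, n + 1}\<close>, and such an atom lies below \<open>P\<close> iff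
  \<open>i\<close> and \<open>j\<close> are in one block of \<open>P\<close>, except that \<open>{i, n}\<close> is not below \<open>P\<close> if \<open>i\<close> is the least
  element of a block of \<open>P\<close> containing \<open>n\<close> and \<open>n + 1\<close>.

  The spokes \<open>{b, n + 1}\<close> are exactly the atoms \<open>e\<close> such that some \<open>P \<noteq> e\<close> has \<open>e\<close> as its only
  atom below it, namely the \<open>P\<close> with block \<open>{b, n, n + 1}\<close>. The spoke of \<open>b\<close> and another atom
  \<open>{i, j}\<close> have an upper bound above no other spoke iff \<open>b < i\<close> or \<open>j < b\<close>. So an automorphism
  permutes the spokes and respects the intervals \<open>{i..min j (n - 1)}\<close> of spokes attached to the other
  atoms. The only atom with interval \<open>{n - 1}\<close> is \<open>{n - 1, n}\<close>, so the spoke of \<open>n - 1\<close> is fixed, and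
  then comparing the sizes of the intervals shows that all atoms are fixed. Finally, two elements
  above the same atoms are comparable, and no automorphism of a finite poset moves an element
  strictly up or down.
\<close>

section \<open>Noncrossing partitions without geometry\<close>

text \<open>The expression is twice the oriented area of the triangle with vertices at angles
  \<open>r\<close>, \<open>s\<close>, \<open>t\<close>. In half-angles it factors as
  \<open>4 * sin \<alpha> * sin \<beta> * sin (\<alpha> + \<beta>)\<close>, and all three arguments
  lie strictly between 0 and pi.\<close>

lemma orientation_pos:
  fixes r s t :: real
  assumes "r < s" "s < t" "t < r + 2 * pi"
  shows "sin (s - r) + sin (t - s) - sin (t - r) > 0"
proof -
  define \<alpha> where "\<alpha> = (s - r) / 2"
  define \<beta> where "\<beta> = (t - s) / 2"
  have eq: "s - r = 2 * \<alpha>" "t - s = 2 * \<beta>" "t - r = 2 * (\<alpha> + \<beta>)"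
    by (auto simp: \<alpha>_def \<beta>_def field_simps)
  have "sin (2 * \<alpha>) + sin (2 * \<beta>) = 2 * sin (\<alpha> + \<beta>) * cos (\<alpha> - \<beta>)"
    by (simp add: sin_plus_sin add_divide_distrib diff_divide_distrib)
  moreover have "sin (2 * (\<alpha> + \<beta>)) = 2 * sin (\<alpha> + \<beta>) * cos (\<alpha> + \<beta>)"
    by (rule sin_double)
  moreover have "cos (\<alpha> - \<beta>) - cos (\<alpha> + \<beta>) = 2 * (sin \<alpha> * sin \<beta>)"
    by (simp add: cos_add cos_diff)
  ultimately have "sin (s - r) + sin (t - s) - sin (t - r) = 4 * (sin (\<alpha> + \<beta>) * (sin \<alpha> * sin \<beta>))"
    unfolding eq by (simp add: algebra_simps)
  moreover have "0 < \<alpha>" "0 < \<beta>" "\<alpha> + \<beta> < pi"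
    using assms by (auto simp: \<alpha>_def \<beta>_def field_simps)
  ultimately show ?thesis
    by (simp add: sin_gt_zero)
qed

text \<open>
  The weights are the oriented areas of the four triangles spanned by the quadrilateral, i.e. the
  coefficients of the affine dependency between its vertices.
\<close>

lemma chords_cross:
  fixes a b c d :: real
  assumes "a < b" "b < c" "c < d" "d < a + 2 * pi"
  shows "\<not> disjnt (convex hull {cis (- a), cis (- c)}) (convex hull {cis (- b), cis (- d)})"
proof -
  define D where "D r s t = sin (s - r) + sin (t - s) - sin (t - r)" for r s t :: real
  have pos: "D b c d > 0" "D a b d > 0" "D a c d > 0" "D a b c > 0"
    using assms unfolding D_def by (intro orientation_pos; linarith)+
  define T where "T = D b c d + D a b d"
  have T: "T = D a c d + D a b c"
    by (simp add: T_def D_def)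
  have "T > 0"
    using pos by (simp add: T_def)
  define z where "z = (D b c d / T) *\<^sub>R cis (- a) + (D a b d / T) *\<^sub>R cis (- c)"
  have "D b c d * cos a + D a b d * cos c = D a c d * cos b + D a b c * cos d"
    unfolding D_def sin_diff by (simp add: algebra_simps)
  moreover have "D b c d * sin a + D a b d * sin c = D a c d * sin b + D a b c * sin d"
    unfolding D_def sin_diff by (simp add: algebra_simps)
  ultimately have z': "z = (D a c d / T) *\<^sub>R cis (- b) + (D a b c / T) *\<^sub>R cis (- d)"
    using \<open>T > 0\<close> by (simp add: z_def complex_eq_iff divide_simps)
  have "z \<in> convex hull {cis (- a), cis (- c)}"
    unfolding convex_hull_2 using pos \<open>T > 0\<close> z_def
    by (intro CollectI exI[of _ "D b c d / T"] exI[of _ "D a b d / T"])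
       (auto simp: T_def simp flip: add_divide_distrib)
  moreover have "z \<in> convex hull {cis (- b), cis (- d)}"
    unfolding convex_hull_2 using pos \<open>T > 0\<close> z'
    by (intro CollectI exI[of _ "D a c d / T"] exI[of _ "D a b c / T"])
       (auto simp: T simp flip: add_divide_distrib)
  ultimately show ?thesis
    by (auto simp: disjnt_def)
qed

text \<open>Cosine decreases up to pi and is symmetric about pi; the product formula for
  \<open>cos s - cos t\<close> covers both sides of pi at once.\<close>

lemma cos_less_cos:
  fixes s t :: real
  assumes "0 \<le> s" "s < t" "t < 2 * pi - s"
  shows "cos t < cos s"
proof -
  have "cos s - cos t = 2 * sin ((s + t) / 2) * sin ((t - s) / 2)"
    by (rule cos_diff_cos)
  moreover have "sin ((s + t) / 2) > 0" "sin ((t - s) / 2) > 0"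
    using assms by (auto intro!: sin_gt_zero)
  ultimately show ?thesis
    by (smt (verit) mult_pos_pos)
qed

lemma inner_cis: "inner (cis a) (cis b) = cos (a - b)"
  by (simp add: inner_complex_def cos_diff)

text \<open>A line perpendicular to the direction \<open>u\<close> of the midpoint of the arc
  separates the two sets: the height of a point in direction \<open>u\<close> is the cosine of its
  angular distance from that midpoint.\<close>

lemma circle_arc_hull_disjnt:
  assumes C: "C \<subseteq> {p..q}" and B: "B \<subseteq> {1..m}" "B \<inter> {p..q} = {}"
    and pq: "1 \<le> p" "p \<le> q" "q \<le> m"
  shows "disjnt (convex hull (circle_point m ` B)) (convex hull (circle_point m ` C))"
proof -
  define s where "s = (real p + real q) / 2"
  \<comment> \<open>Half a step more than the half-width of \<open>{p..q}\<close>, so the line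
    passes strictly between the points of the arc and all other points.\<close>
  define h where "h = (real q - real p + 1) / 2"
  define u where "u = cis (- (2 * pi * s / real m))"
  define \<beta> where "\<beta> = cos (2 * pi * h / real m)"
  have m: "real m > 0"
    using pq by simp
  have h: "h > 0"
    using pq by (simp add: h_def)
  have val: "inner u (circle_point m k) = cos (2 * pi * \<bar>real k - s\<bar> / real m)" for k
  proof -
    have "inner u (circle_point m k) = cos (2 * pi * (real k - s) / real m)"
      by (simp add: u_def circle_point_def inner_cis diff_divide_distrib right_diff_distrib)
    also have "\<dots> = cos \<bar>2 * pi * (real k - s) / real m\<bar>"
      by (rule cos_abs_real [symmetric])
    also have "\<bar>2 * pi * (real k - s) / real m\<bar> = 2 * pi * \<bar>real k - s\<bar> / real m"
      by (simp add: abs_mult)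
    finally show ?thesis .
  qed
  have scale: "2 * pi * x / real m < 2 * pi * y / real m" if "x < y" for x y
    using that m by (simp add: divide_strict_right_mono)
  have inside: "inner u (circle_point m k) > \<beta>" if "k \<in> C" for k
    unfolding val \<beta>_def
  proof (rule cos_less_cos)
    have k: "p \<le> k" "k \<le> q"
      using that C by auto
    then show "2 * pi * \<bar>real k - s\<bar> / real m < 2 * pi * h / real m"
      by (intro scale) (auto simp: s_def h_def field_simps abs_if)
    have "2 * pi * h / real m < 2 * pi * (m - \<bar>real k - s\<bar>) / real m"
      using k pq by (intro scale) (auto simp: s_def h_def field_simps abs_if)
    then show "2 * pi * h / real m < 2 * pi - 2 * pi * \<bar>real k - s\<bar> / real m"
      using m by (simp add: right_diff_distrib diff_divide_distrib)
  qed simp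
  have outside: "inner u (circle_point m k) < \<beta>" if "k \<in> B" for k
    unfolding val \<beta>_def
  proof (rule cos_less_cos)
    have k: "1 \<le> k" "k \<le> m" "k < p \<or> q < k"
      using that B by fastforce+
    then show "2 * pi * h / real m < 2 * pi * \<bar>real k - s\<bar> / real m"
      by (intro scale) (auto simp: s_def h_def field_simps abs_if)
    have "2 * pi * \<bar>real k - s\<bar> / real m < 2 * pi * (m - h) / real m"
      using k pq by (intro scale) (auto simp: s_def h_def field_simps abs_if)
    then show "2 * pi * \<bar>real k - s\<bar> / real m < 2 * pi - 2 * pi * h / real m"
      using m by (simp add: right_diff_distrib diff_divide_distrib)
    show "0 \<le> 2 * pi * h / real m"
      using h by simp
  qed
  have "convex hull (circle_point m ` C) \<subseteq> {z. inner u z > \<beta>}"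
    using inside by (intro hull_minimal) (auto simp: convex_halfspace_gt)
  moreover have "convex hull (circle_point m ` B) \<subseteq> {z. inner u z < \<beta>}"
    using outside by (intro hull_minimal) (auto simp: convex_halfspace_lt)
  ultimately show ?thesis
    by (force simp: disjnt_def)
qed

text \<open>A point \<open>c\<close> of \<open>B\<close> between \<open>Min C\<close> and
  \<open>Max C\<close> would give the crossing \<open>Min B < Min C < c < Max C\<close>. So
  \<open>B\<close> avoids the arc spanned by \<open>C\<close>, and the arc can be cut off by a
  line.\<close>

lemma noncrossing_hulls_disjnt:
  assumes B: "B \<subseteq> {1..m}" "B \<noteq> {}" and C: "C \<subseteq> {1..m}" "C \<noteq> {}"
    and "B \<inter> C = {}" and "Min B < Min C"
    and nc: "\<And>a b c d. a \<in> B \<Longrightarrow> b \<in> C \<Longrightarrow> c \<in> B \<Longrightarrow> d \<in> C \<Longrightarrow> a < b \<Longrightarrow> b < c \<Longrightarrow> c < d \<Longrightarrow> False"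
  shows "disjnt (convex hull (circle_point m ` B)) (convex hull (circle_point m ` C))"
proof (rule circle_arc_hull_disjnt)
  have fin: "finite B" "finite C"
    using B C finite_subset by auto
  have mem: "Min B \<in> B" "Min C \<in> C" "Max C \<in> C"
    using fin B C by auto
  show "C \<subseteq> {Min C..Max C}"
    using fin by auto
  have "c \<notin> {Min C..Max C}" if "c \<in> B" for c
  proof
    assume "c \<in> {Min C..Max C}"
    moreover have "c \<noteq> Min C" "c \<noteq> Max C"
      using that mem \<open>B \<inter> C = {}\<close> by auto
    ultimately show False
      using nc[OF mem(1,2) that mem(3)] \<open>Min B < Min C\<close> by auto
  qed
  then show "B \<inter> {Min C..Max C} = {}"
    by auto
  show "1 \<le> Min C" "Min C \<le> Max C" "Max C \<le> m"
    using mem C fin by (auto simp: subset_iff)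
qed (use B in auto)

lemma crossing_hulls_not_disjnt:
  assumes "a \<in> B" "b \<in> C" "c \<in> B" "d \<in> C" "a < b" "b < c" "c < d" "1 \<le> a" "d \<le> m"
  shows "\<not> disjnt (convex hull (circle_point m ` B)) (convex hull (circle_point m ` C))"
proof -
  define t where "t k = 2 * pi * real k / real m" for k
  have m: "real m > 0"
    using assms by simp
  have mono: "t j < t k" if "j < k" for j k
    using that m by (simp add: t_def divide_strict_right_mono)
  have "t d < t a + 2 * pi"
    using assms mono[of d "a + m"] m by (simp add: t_def field_simps)
  then have "\<not> disjnt (convex hull {cis (- t a), cis (- t c)}) (convex hull {cis (- t b), cis (- t d)})"
    using assms by (intro chords_cross mono)
  moreover have "{cis (- t a), cis (- t c)} \<subseteq> circle_point m ` B"
      "{cis (- t b), cis (- t d)} \<subseteq> circle_point m ` C"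
    using assms by (auto simp: t_def circle_point_def)
  ultimately show ?thesis
    by (meson disjnt_subset1 disjnt_subset2 hull_mono)
qed

section \<open>Noncrossing partitions through their equivalence relations\<close>

text \<open>Partitions are handled as equivalence relations from here on: refinement becomes
  pointwise implication, and crossings can be discussed without naming blocks.\<close>

definition same_block :: "'a set set \<Rightarrow> 'a \<Rightarrow> 'a \<Rightarrow> bool" where
  "same_block P i j \<longleftrightarrow> (\<exists>B\<in>P. i \<in> B \<and> j \<in> B)"

lemma same_block_iff:
  assumes "partition_on A P" "B \<in> P" "i \<in> B"
  shows "same_block P i j \<longleftrightarrow> j \<in> B"
  using assms by (auto simp: same_block_def partition_on_def disjoint_def)

lemma same_block_iff':
  assumes "partition_on A P" "B \<in> P" "i \<in> B"
  shows "same_block P j i \<longleftrightarrow> j \<in> B"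
  using same_block_iff[OF assms] by (auto simp: same_block_def)

text \<open>Alternating points give crossing chords, which make the hulls meet. Conversely, of two
  blocks that do not alternate, the one with the larger minimum spans an arc that the other
  avoids.\<close>

lemma NC_iff:
  "P \<in> NC m \<longleftrightarrow> partition_on {1..m} P \<and>
     (\<forall>a b c d. a < b \<and> b < c \<and> c < d \<and> same_block P a c \<and> same_block P b d \<longrightarrow> same_block P a b)"
  (is "_ \<longleftrightarrow> ?part \<and> ?nc")
proof (intro iffI conjI allI impI; (elim conjE)?)
  assume P: "P \<in> NC m"
  then show part: ?part
    by (simp add: NC_def)
  fix a b c d
  assume ord: "a < b" "b < c" "c < d" and "same_block P a c" "same_block P b d"
  then obtain B C where BC: "B \<in> P" "a \<in> B" "c \<in> B" "C \<in> P" "b \<in> C" "d \<in> C"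
    by (auto simp: same_block_def)
  have "a \<in> {1..m}" "d \<in> {1..m}"
    using BC part by (auto simp: partition_on_def)
  then have "\<not> disjnt (convex hull (circle_point m ` B)) (convex hull (circle_point m ` C))"
    using ord BC by (intro crossing_hulls_not_disjnt) auto
  then have "B = C"
    using P BC by (auto simp: NC_def pairwise_def)
  then show "same_block P a b"
    using BC by (auto simp: same_block_def)
next
  assume part: ?part and nc: ?nc
  have disj: "disjnt (convex hull (circle_point m ` B)) (convex hull (circle_point m ` C))"
    if BC: "B \<in> P" "C \<in> P" "B \<noteq> C" "Min B < Min C" for B C
  proof (rule noncrossing_hulls_disjnt)
    show BC0: "B \<inter> C = {}"
      using BC part by (auto simp: partition_on_def disjoint_def)
    show "B \<subseteq> {1..m}" "C \<subseteq> {1..m}" "B \<noteq> {}" "C \<noteq> {}"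
      using BC part by (auto simp: partition_on_def)
    fix a b c d
    assume *: "a \<in> B" "b \<in> C" "c \<in> B" "d \<in> C" "a < b" "b < c" "c < d"
    then have "same_block P a c" "same_block P b d"
      using BC by (auto simp: same_block_def)
    then have "same_block P a b"
      using nc * by blast
    then show False
      using same_block_iff[OF part BC(1) *(1)] * BC0 by auto
  qed (use BC in auto)
  have "disjnt (convex hull (circle_point m ` B)) (convex hull (circle_point m ` C))"
    if BC: "B \<in> P" "C \<in> P" "B \<noteq> C" for B C
  proof -
    have "B \<inter> C = {}" "B \<subseteq> {1..m}" "C \<subseteq> {1..m}" "B \<noteq> {}" "C \<noteq> {}"
      using BC part by (auto simp: partition_on_def disjoint_def)
    then have "Min B \<noteq> Min C"
      by (metis Min_in disjoint_iff finite_atLeastAtMost finite_subset)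
    then show ?thesis
      using disj[OF BC] disj[OF BC(2,1)] BC(3) disjnt_sym by (metis linorder_neqE_nat)
  qed
  then show "P \<in> NC m"
    using part by (auto simp: NC_def pairwise_def)
qed

section \<open>Merging two blocks\<close>

lemma same_block_refl: "partition_on A P \<Longrightarrow> same_block P i i \<longleftrightarrow> i \<in> A"
  by (auto simp: same_block_def partition_on_def)

lemma same_block_sym: "same_block P i j \<Longrightarrow> same_block P j i"
  by (auto simp: same_block_def)

lemma same_block_trans:
  "partition_on A P \<Longrightarrow> same_block P i j \<Longrightarrow> same_block P j k \<Longrightarrow> same_block P i k"
  unfolding same_block_def by (auto simp: partition_on_def disjoint_def)

lemma same_block_mem: "partition_on A P \<Longrightarrow> same_block P i j \<Longrightarrow> i \<in> A \<and> j \<in> A"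
  by (auto simp: same_block_def partition_on_def)

lemma partition_on_eq_same_block:
  assumes "partition_on A P" "partition_on A Q" "same_block P = same_block Q"
  shows "P = Q"
proof -
  have "A // {(x, y). same_block P x y} = A // {(x, y). same_block Q x y}"
    using assms(3) by metis
  then show ?thesis
    using assms(1,2) by (simp add: same_block_def partition_on_eq_quotient)
qed

lemma refines_iff_same_block:
  assumes P: "partition_on A P" and Q: "partition_on A Q"
  shows "refines A P Q \<longleftrightarrow> same_block P \<le> same_block Q"
proof
  assume "refines A P Q"
  then show "same_block P \<le> same_block Q"
    unfolding refines_def same_block_def by blast
next
  assume le: "same_block P \<le> same_block Q"
  have "\<exists>Y\<in>Q. X \<subseteq> Y" if "X \<in> P" for X
  proof -
    obtain i where "i \<in> X"
      using \<open>X \<in> P\<close> P by (metis ex_in_conv partition_onD3)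
    then obtain Y where "Y \<in> Q" "i \<in> Y"
      using \<open>X \<in> P\<close> P Q by (metis UnionE UnionI partition_onD1)
    moreover have "j \<in> Y" if "j \<in> X" for j
      using le \<open>X \<in> P\<close> \<open>i \<in> X\<close> that same_block_iff[OF Q \<open>Y \<in> Q\<close> \<open>i \<in> Y\<close>]
      unfolding same_block_def by blast
    ultimately show ?thesis
      by blast
  qed
  then show "refines A P Q"
    using P Q by (auto simp: refines_def)
qed

section \<open>Explicit partitions and the refinement order on noncrossing partitions\<close>

text \<open>Explicit partitions are given as kernels of functions, typically updates of
  \<open>id\<close> such as \<open>id(j := i)\<close>, which joins \<open>j\<close> to
  \<open>i\<close>. The noncrossing condition then becomes a case distinction on values.\<close>

definition kernel_partition :: "nat \<Rightarrow> (nat \<Rightarrow> 'b) \<Rightarrow> nat set set" where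
  "kernel_partition m g = (\<lambda>k. {i \<in> {1..m}. g i = g k}) ` {1..m}"

lemma partition_on_kernel_partition: "partition_on {1..m} (kernel_partition m g)"
  by (auto simp: partition_on_def disjoint_def kernel_partition_def)

lemma same_block_kernel_partition [simp]:
  "same_block (kernel_partition m g) i j \<longleftrightarrow> i \<in> {1..m} \<and> j \<in> {1..m} \<and> g i = g j"
  by (auto simp: same_block_def kernel_partition_def)

lemma NC_partition: "P \<in> NC m \<Longrightarrow> partition_on {1..m} P"
  by (simp add: NC_iff)

lemma NC_noncrossing:
  "P \<in> NC m \<Longrightarrow> a < b \<Longrightarrow> b < c \<Longrightarrow> c < d \<Longrightarrow> same_block P a c \<Longrightarrow> same_block P b d \<Longrightarrow> same_block P a b"
  unfolding NC_iff by blast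

lemma kernel_partition_NC:
  assumes "\<And>a b c d. 1 \<le> a \<Longrightarrow> a < b \<Longrightarrow> b < c \<Longrightarrow> c < d \<Longrightarrow> d \<le> m \<Longrightarrow> g a = g c \<Longrightarrow> g b = g d \<Longrightarrow> g a = g b"
  shows "kernel_partition m g \<in> NC m"
  unfolding NC_iff using assms by (auto simp: partition_on_kernel_partition simp del: One_nat_def)

lemma NC_eqI: "P \<in> NC m \<Longrightarrow> Q \<in> NC m \<Longrightarrow> same_block P = same_block Q \<Longrightarrow> P = Q"
  using NC_partition partition_on_eq_same_block by blast

lemma nc_less_iff:
  "nc_less m P Q \<longleftrightarrow> P \<in> NC m \<and> Q \<in> NC m \<and> same_block P \<le> same_block Q \<and> P \<noteq> Q"
  using refines_iff_same_block NC_partition unfolding nc_less_def by blast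

text \<open>If only one of \<open>x\<close>, \<open>y\<close> lay between \<open>q\<close> and
  \<open>s\<close>, the two pairs would alternate and be forced into one block. This locates the
  endpoints of a new chord relative to old ones when two blocks are merged.\<close>

lemma NC_separation:
  assumes P: "P \<in> NC m" and "q < s" "same_block P q s" "same_block P x y" "\<not> same_block P q x"
  shows "q < x \<and> x < s \<longleftrightarrow> q < y \<and> y < s"
proof -
  note tr = same_block_trans[OF NC_partition[OF P]] and sy = same_block_sym[of P]
  have ne: "x \<noteq> q" "x \<noteq> s" "y \<noteq> q" "y \<noteq> s"
    using assms tr sy by metis+
  have "q < v \<and> v < s" if uv: "q < u" "u < s" "same_block P u v" "\<not> same_block P q u" "v \<noteq> q" "v \<noteq> s" for u v
  proof (rule ccontr)
    assume "\<not> (q < v \<and> v < s)"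
    then consider "v < q" | "s < v"
      using uv by linarith
    then show False
      using NC_noncrossing[OF P, of v q u s] NC_noncrossing[OF P, of q u s v] uv assms(3) tr sy
      by cases metis+
  qed
  from this[of x y] this[of y x] show ?thesis
    using assms ne tr sy by metis
qed

section \<open>Covers of the noncrossing partition lattice\<close>

text \<open>Between noncrossing partitions this is the covering relation:
  \<open>merges_between\<close> shows that nothing lies strictly between, and
  \<open>merge_exists\<close> that every strict refinement starts with a merge.\<close>

definition merges :: "nat set set \<Rightarrow> nat set set \<Rightarrow> bool" where
  "merges P Q \<longleftrightarrow> (\<exists>B\<in>P. \<exists>C\<in>P. B \<noteq> C \<and> Q = (P - {B, C}) \<union> {B \<union> C})"

lemma same_block_merge:
  "B \<in> P \<Longrightarrow> C \<in> P \<Longrightarrow> same_block ((P - {B, C}) \<union> {B \<union> C}) i j \<longleftrightarrow>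
     same_block P i j \<or> (i \<in> B \<union> C \<and> j \<in> B \<union> C)"
  by (auto simp: same_block_def)

lemma partition_on_merge:
  "partition_on A P \<Longrightarrow> B \<in> P \<Longrightarrow> C \<in> P \<Longrightarrow> partition_on A ((P - {B, C}) \<union> {B \<union> C})"
  by (auto simp: partition_on_def disjoint_def)

lemma merge_not_in:
  assumes "partition_on A P" "B \<in> P" "C \<in> P" "B \<noteq> C"
  shows "B \<union> C \<notin> P"
proof
  assume "B \<union> C \<in> P"
  moreover have "B \<noteq> {}" "C \<noteq> {}" "disjoint P"
    using assms by (auto simp: partition_on_def)
  ultimately have "B \<union> C = B" "B \<union> C = C"
    using assms(2,3) disjointD by blast+
  with \<open>B \<noteq> C\<close> show False
    by blast
qed

lemma card_merge:
  assumes "partition_on A P" "finite P" "B \<in> P" "C \<in> P" "B \<noteq> C"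
  shows "Suc (card ((P - {B, C}) \<union> {B \<union> C})) = card P"
proof -
  have "card (P - {B, C}) = card P - 2" "2 \<le> card P"
    using assms card_mono[of P "{B, C}"] by (auto simp: card_Diff_subset)
  moreover have "card ((P - {B, C}) \<union> {B \<union> C}) = Suc (card (P - {B, C}))"
    using assms merge_not_in[of A P B C] by simp
  ultimately show ?thesis
    by linarith
qed

lemma NC_finite: "P \<in> NC m \<Longrightarrow> finite P"
  using NC_partition finite_elements by blast

lemma finite_NC: "finite (NC m)"
proof (rule finite_subset)
  show "NC m \<subseteq> Pow (Pow {1..m})"
    using NC_partition by (auto simp: partition_on_def)
qed simp

lemma mergesE:
  assumes "merges P Q"
  obtains B C where "B \<in> P" "C \<in> P" "B \<noteq> C" "Q = (P - {B, C}) \<union> {B \<union> C}"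
  using assms unfolding merges_def by blast

lemma merges_card:
  assumes "P \<in> NC m" "merges P Q"
  shows "Suc (card Q) = card P"
  using assms(2) by (rule mergesE) (metis card_merge NC_partition NC_finite assms(1))

lemma merges_same_block_le:
  assumes "merges P Q"
  shows "same_block P \<le> same_block Q"
  using assms
proof (rule mergesE)
  fix B C
  assume "B \<in> P" "C \<in> P" and Q: "Q = (P - {B, C}) \<union> {B \<union> C}"
  then show ?thesis
    unfolding Q by (intro predicate2I) (simp only: same_block_merge simp_thms)
qed

text \<open>If \<open>R\<close> joins a pair that \<open>P\<close> does not, the pair has one point
  in \<open>B\<close> and one in \<open>C\<close>; since \<open>R\<close> joins everything within
  \<open>B\<close> and within \<open>C\<close>, it joins all of \<open>B \<union> C\<close> and
  equals \<open>Q\<close>.\<close>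

lemma merges_between:
  assumes P: "P \<in> NC m" and R: "R \<in> NC m" and Q: "Q \<in> NC m" and "merges P Q"
    and le: "same_block P \<le> same_block R" "same_block R \<le> same_block Q"
  shows "R = P \<or> R = Q"
proof (rule disjCI)
  assume "R \<noteq> Q"
  obtain B C where BC: "B \<in> P" "C \<in> P" "B \<noteq> C" and Qeq: "Q = (P - {B, C}) \<union> {B \<union> C}"
    using \<open>merges P Q\<close> by (auto simp: merges_def)
  note Q_iff = same_block_merge[OF BC(1,2), folded Qeq]
  note tr = same_block_trans[OF NC_partition[OF R]] and sy = same_block_sym[of R]
  have "same_block R i j \<Longrightarrow> same_block P i j" for i j
  proof (rule ccontr)
    assume ij: "same_block R i j" "\<not> same_block P i j"
    then have U: "i \<in> B \<union> C" "j \<in> B \<union> C"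
      using le(2) Q_iff by blast+
    have P_BC: "same_block P x y" if "x \<in> B \<and> y \<in> B \<or> x \<in> C \<and> y \<in> C" for x y
      using that BC by (auto simp: same_block_def)
    have *: "same_block R x y" if "x \<in> B \<and> y \<in> B \<or> x \<in> C \<and> y \<in> C" for x y
      using le(1) P_BC[OF that] by blast
    have "i \<in> B \<and> j \<in> C \<or> i \<in> C \<and> j \<in> B"
      using U P_BC ij(2) by blast
    then have "same_block R x y" if "x \<in> B \<union> C" "y \<in> B \<union> C" for x y
      using that * ij(1) tr sy by (metis Un_iff)
    then have "same_block Q \<le> same_block R"
      using le(1) Q_iff by blast
    then have "R = Q"
      using le(2) R Q NC_eqI order_antisym by blast
    with \<open>R \<noteq> Q\<close> show False ..
  qed
  then have "same_block R = same_block P"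
    using le(1) by blast
  then show "R = P"
    using P R NC_eqI by blast
qed

text \<open>
  The two blocks to merge contain the two closest points which are together in \<open>Q\<close> but not in
  \<open>P\<close>: then no block of \<open>P\<close> inside the same block of \<open>Q\<close> has a point between these two.
\<close>

lemma merge_exists:
  assumes P: "P \<in> NC m" and Q: "Q \<in> NC m"
    and le: "same_block P \<le> same_block Q" and "P \<noteq> Q"
  obtains R where "R \<in> NC m" "merges P R" "same_block R \<le> same_block Q"
proof -
  note trP = same_block_trans[OF NC_partition[OF P]] and syP = same_block_sym[of P]
  note trQ = same_block_trans[OF NC_partition[OF Q]] and syQ = same_block_sym[of Q]
  define good where "good d \<longleftrightarrow> (\<exists>a. same_block Q a (a + d) \<and> \<not> same_block P a (a + d))" for d
  have "\<not> same_block Q \<le> same_block P"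
    using \<open>P \<noteq> Q\<close> le P Q NC_eqI order_antisym by blast
  then obtain i j where ij: "same_block Q i j" "\<not> same_block P i j"
    by blast
  have "\<exists>d. good d"
  proof (cases "i \<le> j")
    case True
    then show ?thesis
      using ij unfolding good_def by (intro exI[of _ "j - i"] exI[of _ i]) simp
  next
    case False
    then show ?thesis
      using ij syP[of j i] syQ[of i j] unfolding good_def
      by (intro exI[of _ "i - j"] exI[of _ j]) auto
  qed
  define d where "d = (LEAST d. good d)"
  have "good d"
    using \<open>\<exists>d. good d\<close> by (auto simp: d_def intro: LeastI)
  then obtain a where "same_block Q a (a + d)" "\<not> same_block P a (a + d)"
    by (auto simp: good_def)
  moreover define c where "c = a + d"
  ultimately have ac: "same_block Q a c" "\<not> same_block P a c"
    by auto
  have minimal: "same_block P x y" if "same_block Q x y" "x < y" "y - x < c - a" for x y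
  proof -
    have "y - x < d"
      using that(3) by (simp add: c_def)
    then have "\<not> good (y - x)"
      unfolding d_def by (rule not_less_Least)
    then show ?thesis
      using that by (auto simp: good_def dest: spec[of _ x])
  qed
  have gap: "\<not> same_block Q a t" if "a < t" "t < c" for t
  proof
    assume "same_block Q a t"
    moreover from this have "same_block Q t c"
      using ac trQ syQ by metis
    ultimately have "same_block P a t" "same_block P t c"
      using that by (auto intro!: minimal)
    then show False
      using ac trP by metis
  qed
  have mem: "a \<in> {1..m}" "c \<in> {1..m}"
    using same_block_mem[OF NC_partition[OF Q] ac(1)] by auto
  have "a < c"
  proof (rule ccontr)
    assume "\<not> a < c"
    then have "a = c"
      by (simp add: c_def)
    then show False
      using ac mem same_block_refl[OF NC_partition[OF P]] by auto
  qed
  obtain B C where BC: "B \<in> P" "a \<in> B" "C \<in> P" "c \<in> C"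
    using mem NC_partition[OF P] unfolding partition_on_def by blast
  note B_iff = same_block_iff'[OF NC_partition[OF P] BC(1,2)]
  note C_iff = same_block_iff'[OF NC_partition[OF P] BC(3,4)]
  have "B \<noteq> C"
    using ac BC by (auto simp: same_block_def)
  define R where "R = (P - {B, C}) \<union> {B \<union> C}"
  have R_iff: "same_block R i j \<longleftrightarrow> same_block P i j \<or>
      ((same_block P i a \<or> same_block P i c) \<and> (same_block P j a \<or> same_block P j c))" for i j
    unfolding R_def B_iff C_iff by (subst same_block_merge) (use BC in auto)
  have part: "partition_on {1..m} R"
    unfolding R_def using BC NC_partition[OF P] by (intro partition_on_merge)
  have RQ: "same_block R \<le> same_block Q"
  proof (rule predicate2I)
    fix i j
    have "same_block Q i c" if "same_block P i a \<or> same_block P i c" for i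
      using that le ac(1) trQ by blast
    moreover assume "same_block R i j"
    ultimately show "same_block Q i j"
      unfolding R_iff using le trQ syQ by blast
  qed
  have nc: "same_block R p q"
    if ord: "p < q" "q < r" "r < s" and pr: "same_block R p r" and qs: "same_block R q s" for p q r s
  proof (rule ccontr)
    assume neg: "\<not> same_block R p q"
    have Q_pr: "same_block Q p r" and Q_qs: "same_block Q q s"
      using pr qs RQ by auto
    have neg': "\<not> same_block P p q" "\<not> same_block P q p"
        "\<not> ((same_block P p a \<or> same_block P p c) \<and> (same_block P q a \<or> same_block P q c))"
      using neg unfolding R_iff by (blast dest: syP)+
    have R_cases: "same_block P x y \<or> same_block P x a \<and> same_block P y c \<or> same_block P x c \<and> same_block P y a"
      if "same_block R x y" for x y
      using that unfolding R_iff by (blast intro: trP syP)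
    \<comment> \<open>A pair joined in \<open>R\<close> is joined in \<open>P\<close> or bridges
      \<open>a\<close> and \<open>c\<close>; both pairs cannot bridge, as \<open>p\<close> and
      \<open>q\<close> are apart in \<open>R\<close>. If exactly one bridges,
      \<open>NC_separation\<close> places \<open>a\<close> and \<open>c\<close> on different sides
      of the other pair. The chord from \<open>a\<close> to \<open>c\<close> then crosses that pair,
      so \<open>Q\<close> has a point of their block strictly between \<open>a\<close> and
      \<open>c\<close>, against \<open>gap\<close>.\<close>
    consider "same_block P p r" "same_block P q s"
      | "same_block P q s" "same_block P p a" "same_block P r c"
      | "same_block P q s" "same_block P p c" "same_block P r a"
      | "same_block P p r" "same_block P q a" "same_block P s c"
      | "same_block P p r" "same_block P q c" "same_block P s a"
      using R_cases[OF pr] R_cases[OF qs] neg'(3) by blast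
    then show False
    proof cases
      case 1
      then show False
        using NC_noncrossing[OF P ord] neg' by blast
    next
      case 2
      then have "\<not> same_block P q p" "\<not> same_block P q r"
        using neg' by (blast intro: trP syP)+
      then have "\<not> (q < a \<and> a < s)" "q < c \<and> c < s"
        using NC_separation[OF P _ 2(1) 2(2)] NC_separation[OF P _ 2(1) 2(3)] ord by auto
      moreover have "a \<noteq> q"
        using 2 neg' by blast
      ultimately have "a < q" "q < c" "c < s"
        using \<open>a < c\<close> by linarith+
      then show False
        using NC_noncrossing[OF Q _ _ _ ac(1) Q_qs] gap by blast
    next
      case 3
      then have "\<not> same_block P q p" "\<not> same_block P q r"
        using neg' by (blast intro: trP syP)+
      then have "\<not> (q < c \<and> c < s)" "q < a \<and> a < s"
        using NC_separation[OF P _ 3(1) 3(2)] NC_separation[OF P _ 3(1) 3(3)] ord by auto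
      moreover have "c \<noteq> s"
        using 3 neg' by blast
      ultimately have *: "q < a" "a < s" "s < c"
        using \<open>a < c\<close> by linarith+
      then have "same_block Q q a"
        using NC_noncrossing[OF Q _ _ _ Q_qs ac(1)] by blast
      then show False
        using gap[of s] * Q_qs trQ syQ by metis
    next
      case 4
      then have "\<not> same_block P p q" "\<not> same_block P p s"
        using neg' by (blast intro: trP syP)+
      then have "p < a \<and> a < r" "\<not> (p < c \<and> c < r)"
        using NC_separation[OF P _ 4(1) 4(2)] NC_separation[OF P _ 4(1) 4(3)] ord by auto
      moreover have "c \<noteq> r"
        using 4 neg' by blast
      ultimately have *: "p < a" "a < r" "r < c"
        using \<open>a < c\<close> by linarith+
      then have "same_block Q p a"
        using NC_noncrossing[OF Q _ _ _ Q_pr ac(1)] by blast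
      then show False
        using gap[of r] * Q_pr trQ syQ by metis
    next
      case 5
      then have "\<not> same_block P p q" "\<not> same_block P p s"
        using neg' by (blast intro: trP syP)+
      then have "p < c \<and> c < r" "\<not> (p < a \<and> a < r)"
        using NC_separation[OF P _ 5(1) 5(2)] NC_separation[OF P _ 5(1) 5(3)] ord by auto
      moreover have "a \<noteq> p"
        using 5 neg' trP[OF 5(1) syP[OF 5(1)]] by blast
      ultimately have "a < p" "p < c" "c < r"
        using \<open>a < c\<close> by linarith+
      then show False
        using NC_noncrossing[OF Q _ _ _ ac(1) Q_pr] gap by blast
    qed
  qed
  have "R \<in> NC m"
    unfolding NC_iff using part nc by blast
  moreover have "merges P R"
    unfolding merges_def R_def using BC \<open>B \<noteq> C\<close> by blast
  ultimately show ?thesis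
    using RQ that by blast
qed

section \<open>Labels of chains\<close>

lemma NC_block:
  assumes "P \<in> NC m" "B \<in> P"
  shows "B \<subseteq> {1..m}" "finite B" "B \<noteq> {}"
proof -
  show "B \<subseteq> {1..m}" "B \<noteq> {}"
    using NC_partition[OF assms(1)] assms(2) by (auto simp: partition_on_def)
  then show "finite B"
    by (auto intro: finite_subset)
qed

lemma NC_block_disjoint: "P \<in> NC m \<Longrightarrow> B \<in> P \<Longrightarrow> C \<in> P \<Longrightarrow> B \<noteq> C \<Longrightarrow> B \<inter> C = {}"
  using NC_partition by (metis disjointD partition_onD2)

lemma mergesE_Min:
  assumes P: "P \<in> NC m" and "merges P Q"
  obtains B C where "B \<in> P" "C \<in> P" "B \<noteq> C" "Q = (P - {B, C}) \<union> {B \<union> C}" "Min (B \<union> C) \<in> B"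
proof -
  obtain B C where BC: "B \<in> P" "C \<in> P" "B \<noteq> C" "Q = (P - {B, C}) \<union> {B \<union> C}"
    using assms(2) by (rule mergesE)
  have "finite (B \<union> C)" "B \<union> C \<noteq> {}"
    using BC NC_block[OF P] by auto
  then have "Min (B \<union> C) \<in> B \<union> C"
    by (rule Min_in)
  then consider "Min (B \<union> C) \<in> B" | "Min (C \<union> B) \<in> C"
    by (auto simp: Un_commute)
  then show ?thesis
  proof cases
    case 1
    then show ?thesis
      using BC that by blast
  next
    case 2
    moreover have "Q = (P - {C, B}) \<union> {C \<union> B}"
      using BC(4) by (simp add: insert_commute Un_commute)
    ultimately show ?thesis
      using that[of C B] BC by metis
  qed
qed

text \<open>The unordered pair is the set of blocks of \<open>P\<close> that the merge removes, and
  the position of the minimum orders it. Hence the definite description in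
  \<open>cover_label\<close> has exactly one value.\<close>

lemma cover_label_merge:
  assumes P: "P \<in> NC m" and BC: "B \<in> P" "C \<in> P" "B \<noteq> C" and min: "Min (B \<union> C) \<in> B"
  shows "cover_label P ((P - {B, C}) \<union> {B \<union> C}) = Max {i \<in> B. \<forall>j\<in>C. i < j}"
  unfolding cover_label_def
proof (rule the_equality)
  show "\<exists>B\<^sub>1\<in>P. \<exists>B\<^sub>2\<in>P. B\<^sub>1 \<noteq> B\<^sub>2 \<and> P - {B, C} \<union> {B \<union> C} = P - {B\<^sub>1, B\<^sub>2} \<union> {B\<^sub>1 \<union> B\<^sub>2} \<and>
      Min (B\<^sub>1 \<union> B\<^sub>2) \<in> B\<^sub>1 \<and> Max {i \<in> B. \<forall>j\<in>C. i < j} = Max {i \<in> B\<^sub>1. \<forall>j\<in>B\<^sub>2. i < j}"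
    using assms by blast
next
  fix l
  assume "\<exists>B\<^sub>1\<in>P. \<exists>B\<^sub>2\<in>P. B\<^sub>1 \<noteq> B\<^sub>2 \<and> P - {B, C} \<union> {B \<union> C} = P - {B\<^sub>1, B\<^sub>2} \<union> {B\<^sub>1 \<union> B\<^sub>2} \<and>
      Min (B\<^sub>1 \<union> B\<^sub>2) \<in> B\<^sub>1 \<and> l = Max {i \<in> B\<^sub>1. \<forall>j\<in>B\<^sub>2. i < j}"
  then obtain B' C' where *: "B' \<in> P" "C' \<in> P" "B' \<noteq> C'"
      "P - {B, C} \<union> {B \<union> C} = P - {B', C'} \<union> {B' \<union> C'}"
      "Min (B' \<union> C') \<in> B'" "l = Max {i \<in> B'. \<forall>j\<in>C'. i < j}"
    by blast
  have "P - (P - {X, Y} \<union> {X \<union> Y}) = {X, Y}" if "X \<in> P" "Y \<in> P" "X \<noteq> Y" for X Y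
    using merge_not_in[OF NC_partition[OF P] that] that by auto
  then have "{B, C} = {B', C'}"
    using * BC by metis
  moreover have "\<not> (B' = C \<and> C' = B)"
  proof
    assume "B' = C \<and> C' = B"
    then have "Min (B \<union> C) \<in> C"
      using *(5) by (simp add: Un_commute)
    then show False
      using min NC_block_disjoint[OF P BC] by blast
  qed
  ultimately show "l = Max {i \<in> B. \<forall>j\<in>C. i < j}"
    using * by (metis doubleton_eq_iff)
qed

lemma cover_labelE:
  assumes P: "P \<in> NC m" and "merges P Q"
  obtains B C where "B \<in> P" "C \<in> P" "B \<noteq> C" "Q = (P - {B, C}) \<union> {B \<union> C}"
    "cover_label P Q \<in> B" "\<And>j. j \<in> C \<Longrightarrow> cover_label P Q < j"
    "\<And>i. i \<in> B \<Longrightarrow> (\<And>j. j \<in> C \<Longrightarrow> i < j) \<Longrightarrow> i \<le> cover_label P Q"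
proof -
  obtain B C where BC: "B \<in> P" "C \<in> P" "B \<noteq> C" and Q: "Q = (P - {B, C}) \<union> {B \<union> C}"
    and min: "Min (B \<union> C) \<in> B"
    using assms by (rule mergesE_Min)
  let ?L = "{i \<in> B. \<forall>j\<in>C. i < j}"
  have label: "cover_label P Q = Max ?L"
    unfolding Q using P BC min by (rule cover_label_merge)
  have "finite B" "finite C" "B \<inter> C = {}"
    using BC NC_block[OF P] NC_block_disjoint[OF P] by auto
  then have "finite ?L" "Min (B \<union> C) \<in> ?L"
    using min by (auto intro!: le_neq_implies_less)
  then have "Max ?L \<in> ?L"
    by (intro Max_in) auto
  then show ?thesis
    using that[OF BC Q] \<open>finite ?L\<close> unfolding label by (auto intro: Max_ge)
qed

text \<open>All elements of \<open>C\<close> exceed the label, so the label \<open>n\<close> forces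
  \<open>C = {Suc n}\<close> with \<open>n\<close> in \<open>B\<close>. Conversely, a block
  \<open>{Suc n}\<close> can only play the part of \<open>C\<close>, and then \<open>n\<close> is
  the largest candidate in \<open>B\<close>.\<close>

lemma cover_label_eq_iff:
  assumes P: "P \<in> NC (Suc n)" and "merges P Q" and "n \<ge> 1"
  shows "cover_label P Q = n \<longleftrightarrow> {Suc n} \<in> P \<and> same_block Q n (Suc n)"
proof -
  obtain B C where BC: "B \<in> P" "C \<in> P" "B \<noteq> C" and Q: "Q = (P - {B, C}) \<union> {B \<union> C}"
    and l: "cover_label P Q \<in> B" "\<And>j. j \<in> C \<Longrightarrow> cover_label P Q < j"
      "\<And>i. i \<in> B \<Longrightarrow> (\<And>j. j \<in> C \<Longrightarrow> i < j) \<Longrightarrow> i \<le> cover_label P Q"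
    using P assms(2) by (rule cover_labelE) blast
  note part = NC_partition[OF P]
  have sub: "B \<subseteq> {1..Suc n}" "C \<subseteq> {1..Suc n}" "C \<noteq> {}"
    using BC NC_block[OF P] by blast+
  show ?thesis
  proof
    assume n: "cover_label P Q = n"
    have "j = Suc n" if "j \<in> C" for j
      using l(2)[OF that] sub(2) that unfolding n by (auto dest: subsetD)
    then have "C = {Suc n}"
      using sub(3) by blast
    moreover have "n \<in> B"
      using l(1) unfolding n .
    ultimately show "{Suc n} \<in> P \<and> same_block Q n (Suc n)"
      using BC unfolding Q by (auto simp: same_block_def)
  next
    assume *: "{Suc n} \<in> P \<and> same_block Q n (Suc n)"
    then have "\<not> same_block P n (Suc n)"
      using same_block_iff'[OF part, of "{Suc n}" "Suc n" n] by auto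
    then have U: "n \<in> B \<union> C" "Suc n \<in> B \<union> C"
      using * unfolding Q same_block_merge[OF BC(1,2)] by auto
    have single: "X = {Suc n}" if "X \<in> P" "Suc n \<in> X" for X
      using NC_block_disjoint[OF P, of X "{Suc n}"] * that by blast
    have "Suc n \<notin> B"
    proof
      assume "Suc n \<in> B"
      then have "B = {Suc n}"
        using single BC by blast
      moreover obtain j where "j \<in> C"
        using sub(3) by blast
      ultimately show False
        using l(1) l(2)[of j] sub(2) by (auto dest: subsetD)
    qed
    then have C: "C = {Suc n}"
      using U(2) single[OF BC(2)] by blast
    then have "n \<in> B"
      using U(1) by auto
    with C have "n \<le> cover_label P Q" "cover_label P Q < Suc n"
      using l by auto
    then show "cover_label P Q = n"
      by simp
  qed
qed

section \<open>Label words of chains are parking functions\<close>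

text \<open>A potential for the parking condition: for \<open>k\<close> from 1 to \<open>n\<close>
  it falls from \<open>Suc n - k\<close> at the bottom to 1 at the top and loses at least one at
  each label above \<open>k\<close>, so at most \<open>n - k\<close> labels exceed
  \<open>k\<close>.\<close>

definition blocks_above :: "nat \<Rightarrow> nat set set \<Rightarrow> nat" where
  "blocks_above k P = card {B \<in> P. \<exists>x\<in>B. k < x}"

text \<open>If the label exceeds \<open>k\<close>, both merged blocks reach beyond \<open>k\<close>:
  \<open>B\<close> contains the label and all of \<open>C\<close> is larger. Their union is counted
  only once.\<close>

lemma blocks_above_step:
  assumes P: "P \<in> NC m" and "merges P Q"
  shows "blocks_above k Q + (if k < cover_label P Q then 1 else 0) \<le> blocks_above k P"
proof -
  obtain B C where BC: "B \<in> P" "C \<in> P" "B \<noteq> C" and Q: "Q = (P - {B, C}) \<union> {B \<union> C}"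
    and l: "cover_label P Q \<in> B" "\<And>j. j \<in> C \<Longrightarrow> cover_label P Q < j"
    using P assms(2) by (rule cover_labelE) blast
  define D where "D = {X \<in> P - {B, C}. \<exists>x\<in>X. k < x}"
  have fin: "finite D" "B \<notin> D" "C \<notin> D"
    using NC_finite[OF P] by (auto simp: D_def)
  have Peq: "{X \<in> P. \<exists>x\<in>X. k < x} = D \<union> (if \<exists>x\<in>B. k < x then {B} else {}) \<union> (if \<exists>x\<in>C. k < x then {C} else {})"
    using BC by (auto simp: D_def)
  have Qeq: "{X \<in> Q. \<exists>x\<in>X. k < x} = D \<union> (if \<exists>x\<in>B \<union> C. k < x then {B \<union> C} else {})"
    by (auto simp: D_def Q)
  have cardQ: "blocks_above k Q \<le> card D + (if \<exists>x\<in>B \<union> C. k < x then 1 else 0)"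
    unfolding blocks_above_def Qeq using fin by (auto simp: card_insert_if)
  have cardP: "blocks_above k P = card D + (if \<exists>x\<in>B. k < x then 1 else 0) + (if \<exists>x\<in>C. k < x then 1 else 0)"
    unfolding blocks_above_def Peq using fin BC by auto
  have "C \<noteq> {}"
    using BC NC_block[OF P] by blast
  then have both: "(\<exists>x\<in>B. k < x) \<and> (\<exists>x\<in>C. k < x)" if "k < cover_label P Q"
    using that l by (meson all_not_in_conv order_less_trans)
  show ?thesis
    using cardP cardQ both by (auto split: if_splits)
qed

lemma chain_labels_Cons: "chain_labels (P # Q # c) = cover_label P Q # chain_labels (Q # c)"
  unfolding chain_labels_def
  by (simp add: upt_conv_Cons map_Suc_upt [symmetric] del: upt_Suc)

lemma chain_labels_count:
  assumes "c \<noteq> []" "set c \<subseteq> NC m" "successively merges c"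
  shows "blocks_above k (last c) + length (filter ((<) k) (chain_labels c)) \<le> blocks_above k (hd c)"
  using assms
proof (induction c rule: induct_list012)
  case (3 P Q c)
  then have "blocks_above k Q + (if k < cover_label P Q then 1 else 0) \<le> blocks_above k P"
    by (intro blocks_above_step) auto
  with 3 show ?case
    by (auto simp: chain_labels_Cons)
qed (simp_all add: chain_labels_def)

lemma card_chain:
  assumes "c \<noteq> []" "set c \<subseteq> NC m" "successively merges c"
  shows "card (last c) + length c = Suc (card (hd c))"
  using assms
proof (induction c rule: induct_list012)
  case (3 P Q c)
  then show ?case
    using merges_card[of P m Q] by auto
qed simp_all

text \<open>If the \<open>k\<close>-th smallest entry exceeded \<open>k\<close>, so would all
  entries from there on, which are \<open>length a - k + 1\<close> many.\<close>

lemma sort_nth_le: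
  fixes a :: "nat list"
  assumes "length (filter ((<) k) a) \<le> length a - k" "1 \<le> k" "k \<le> length a"
  shows "sort a ! (k - 1) \<le> k"
proof (rule ccontr)
  assume neg: "\<not> sort a ! (k - 1) \<le> k"
  have "length (filter ((<) k) a) = length (filter ((<) k) (sort a))"
    by (metis mset_filter mset_sort size_mset)
  also have "\<dots> = card {i. i < length a \<and> k < sort a ! i}"
    by (simp add: length_filter_conv_card)
  also have "\<dots> \<ge> card {k - 1..<length a}"
  proof (rule card_mono)
    show "{k - 1..<length a} \<subseteq> {i. i < length a \<and> k < sort a ! i}"
    proof
      fix i
      assume i: "i \<in> {k - 1..<length a}"
      then have "sort a ! (k - 1) \<le> sort a ! i"
        by (intro sorted_nth_mono) auto
      then show "i \<in> {i. i < length a \<and> k < sort a ! i}"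
        using i neg by simp
    qed
  qed simp
  finally show False
    using assms by simp
qed

definition NC_bot :: "nat \<Rightarrow> nat set set" where
  "NC_bot m = kernel_partition m id"

definition NC_top :: "nat \<Rightarrow> nat set set" where
  "NC_top m = kernel_partition m (\<lambda>_. ())"

lemma same_block_NC_bot [simp]: "same_block (NC_bot m) i j \<longleftrightarrow> i \<in> {1..m} \<and> j = i"
  by (auto simp: NC_bot_def)

lemma same_block_NC_top [simp]: "same_block (NC_top m) i j \<longleftrightarrow> i \<in> {1..m} \<and> j \<in> {1..m}"
  by (auto simp: NC_top_def)

lemma NC_bot_NC [simp, intro]: "NC_bot m \<in> NC m"
  unfolding NC_bot_def by (rule kernel_partition_NC) simp

lemma NC_top_NC [simp, intro]: "NC_top m \<in> NC m"
  unfolding NC_top_def by (rule kernel_partition_NC) simp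

lemma NC_bot_least: "P \<in> NC m \<Longrightarrow> same_block (NC_bot m) \<le> same_block P"
  using same_block_refl[OF NC_partition] by (auto intro!: predicate2I)

lemma NC_top_greatest: "P \<in> NC m \<Longrightarrow> same_block P \<le> same_block (NC_top m)"
  using same_block_mem[OF NC_partition] by (intro predicate2I) fastforce

lemma NC_bot_eq: "NC_bot m = (\<lambda>i. {i}) ` {1..m}"
  by (auto simp: NC_bot_def kernel_partition_def)

lemma NC_top_eq: "m \<ge> 1 \<Longrightarrow> NC_top m = {{1..m}}"
  by (auto simp: NC_top_def kernel_partition_def)

text \<open>Reduces membership of a label word in \<open>parking_functions_avoiding_max n\<close> to
  the absence of the label \<open>n\<close>.\<close>

lemma chain_labels_parking:
  assumes "n \<ge> 1" and c: "c \<noteq> []" "set c \<subseteq> NC (Suc n)" "successively merges c"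
    and ends: "hd c = NC_bot (Suc n)" "last c = NC_top (Suc n)"
  shows "chain_labels c \<in> parking_functions n"
proof -
  have "length c = Suc n"
    using card_chain[OF c] unfolding ends by (simp add: NC_bot_eq NC_top_eq card_image)
  then have len: "length (chain_labels c) = n"
    by (simp add: chain_labels_def)
  have "1 \<le> x" if x: "x \<in> set (chain_labels c)" for x
  proof -
    obtain i where i: "Suc i < length c" "x = cover_label (c ! i) (c ! Suc i)"
      using x by (auto simp: chain_labels_def less_diff_conv)
    then have "c ! i \<in> NC (Suc n)" "merges (c ! i) (c ! Suc i)"
      using c by (auto simp: successively_nth subset_iff)
    then obtain B C where "B \<in> c ! i" "x \<in> B"
      unfolding i(2) by (rule cover_labelE) blast
    then show ?thesis
      using NC_partition[OF \<open>c ! i \<in> NC (Suc n)\<close>] by (auto simp: partition_on_def)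
  qed
  moreover have "sort (chain_labels c) ! (k - 1) \<le> k" if "k \<in> {1..n}" for k
  proof (rule sort_nth_le)
    have "blocks_above k (NC_bot (Suc n)) = card ((\<lambda>i. {i}) ` {k<..Suc n})"
      unfolding blocks_above_def NC_bot_eq by (rule arg_cong[of _ _ card]) auto
    then have "blocks_above k (NC_bot (Suc n)) = Suc n - k"
      by (simp add: card_image)
    moreover have "{B \<in> NC_top (Suc n). \<exists>x\<in>B. k < x} = {{1..Suc n}}"
      using that by (auto simp: NC_top_eq intro!: bexI[of _ "Suc n"])
    then have "blocks_above k (NC_top (Suc n)) = 1"
      by (simp add: blocks_above_def)
    ultimately show "length (filter ((<) k) (chain_labels c)) \<le> length (chain_labels c) - k"
      using chain_labels_count[OF c, of k] that unfolding ends len by simp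
  qed (use that len in auto)
  ultimately show ?thesis
    using len by (simp add: parking_functions_def)
qed

section \<open>Maximal chains\<close>

lemma nc_less_trans: "nc_less m P Q \<Longrightarrow> nc_less m Q R \<Longrightarrow> nc_less m P R"
  unfolding nc_less_iff by (metis NC_eqI order_antisym order_trans)

lemma nc_less_asym: "nc_less m P Q \<Longrightarrow> \<not> nc_less m Q P"
  unfolding nc_less_iff by (metis NC_eqI order_antisym)

lemma merges_nc_less:
  assumes "P \<in> NC m" "Q \<in> NC m" "merges P Q"
  shows "nc_less m P Q"
  unfolding nc_less_iff using assms merges_same_block_le merges_card by fastforce

lemma maxchain_absorbs:
  assumes max: "pred_on.maxchain (NC m) (nc_less m) X" and "Q \<in> NC m"
    and "\<And>P. P \<in> X \<Longrightarrow> P = Q \<or> nc_less m P Q \<or> nc_less m Q P"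
  shows "Q \<in> X"
proof (rule ccontr)
  assume "Q \<notin> X"
  moreover have "pred_on.chain (NC m) (nc_less m) (insert Q X)"
    using assms unfolding pred_on.maxchain_def pred_on.chain_def by blast
  ultimately show False
    using max unfolding pred_on.maxchain_def by blast
qed

text \<open>By \<open>maxchain_absorbs\<close>, whatever is comparable with the whole chain lies on
  it. This applies to the bottom, to the top, and to a merge of \<open>c ! i\<close> that refines
  \<open>c ! Suc i\<close>; the latter must then be \<open>c ! Suc i\<close> itself.\<close>

lemma nc_max_chains_steps:
  assumes c: "c \<in> nc_max_chains m" and "m \<ge> 1"
  shows "c \<noteq> []" "set c \<subseteq> NC m" "hd c = NC_bot m" "last c = NC_top m" "successively merges c"
proof -
  have sorted: "sorted_wrt (nc_less m) c"
    and max: "pred_on.maxchain (NC m) (nc_less m) (set c)"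
    using c by (auto simp: nc_max_chains_def)
  show sub: "set c \<subseteq> NC m"
    using max by (auto simp: pred_on.maxchain_def pred_on.chain_def)
  have bot: "NC_bot m \<in> set c"
    using sub NC_bot_least by (intro maxchain_absorbs[OF max]) (auto simp: nc_less_iff subset_iff)
  then show ne: "c \<noteq> []"
    by auto
  have top: "NC_top m \<in> set c"
    using sub NC_top_greatest by (intro maxchain_absorbs[OF max]) (auto simp: nc_less_iff subset_iff)
  have less: "nc_less m (c ! i) (c ! j)" if "i < j" "j < length c" for i j
    using sorted that by (simp add: sorted_wrt_iff_nth_less)
  show "hd c = NC_bot m"
  proof -
    obtain i where i: "i < length c" "c ! i = NC_bot m"
      using bot by (auto simp: in_set_conv_nth)
    have "i = 0"
    proof (rule ccontr)
      assume "i \<noteq> 0"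
      then have "nc_less m (c ! 0) (NC_bot m)"
        using less[of 0 i] i by simp
      moreover have "same_block (NC_bot m) \<le> same_block (c ! 0)"
        using calculation by (intro NC_bot_least) (simp add: nc_less_iff)
      ultimately show False
        unfolding nc_less_iff by (metis NC_eqI order_antisym)
    qed
    then show ?thesis
      using i ne by (simp add: hd_conv_nth)
  qed
  show "last c = NC_top m"
  proof -
    obtain i where i: "i < length c" "c ! i = NC_top m"
      using top by (auto simp: in_set_conv_nth)
    have "i = length c - 1"
    proof (rule ccontr)
      assume "i \<noteq> length c - 1"
      then have "nc_less m (NC_top m) (c ! (length c - 1))"
        using less[of i "length c - 1"] i by simp
      moreover have "same_block (c ! (length c - 1)) \<le> same_block (NC_top m)"
        using calculation by (intro NC_top_greatest) (simp add: nc_less_iff)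
      ultimately show False
        unfolding nc_less_iff by (metis NC_eqI order_antisym)
    qed
    then show ?thesis
      using i ne by (simp add: last_conv_nth)
  qed
  show "successively merges c"
    unfolding successively_conv_nth
  proof (intro allI impI)
    fix i
    assume i: "Suc i < length c"
    have step: "nc_less m (c ! i) (c ! Suc i)"
      using less i by simp
    then obtain R where R: "R \<in> NC m" "merges (c ! i) R" "same_block R \<le> same_block (c ! Suc i)"
      using merge_exists[of "c ! i" m "c ! Suc i"] by (auto simp: nc_less_iff)
    have iR: "nc_less m (c ! i) R"
      using R step by (intro merges_nc_less) (auto simp: nc_less_iff)
    have Ri: "R = c ! Suc i \<or> nc_less m R (c ! Suc i)"
      using R step by (auto simp: nc_less_iff)
    have side: "nc_less m (c ! j) R \<or> c ! j = R \<or> nc_less m R (c ! j)" if j: "j < length c" for j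
    proof (cases "j \<le> i")
      case True
      then show ?thesis
        using less[of j i] i iR nc_less_trans[of m "c ! j" "c ! i" R] by (cases "j = i") auto
    next
      case False
      then have "c ! Suc i = c ! j \<or> nc_less m (c ! Suc i) (c ! j)"
        using less[of "Suc i" j] j by (cases "j = Suc i") auto
      then show ?thesis
        using Ri nc_less_trans by metis
    qed
    have "R \<in> set c"
    proof (rule maxchain_absorbs[OF max R(1)])
      fix P
      assume "P \<in> set c"
      then show "P = R \<or> nc_less m P R \<or> nc_less m R P"
        using side by (metis in_set_conv_nth)
    qed
    then obtain k where k: "k < length c" "c ! k = R"
      by (auto simp: in_set_conv_nth)
    have "\<not> k \<le> i"
    proof
      assume "k \<le> i"
      then have "c ! k = c ! i \<or> nc_less m (c ! k) (c ! i)"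
        using less[of k i] i by (cases "k = i") auto
      then show False
        using iR nc_less_asym k by metis
    qed
    then have "R = c ! Suc i \<or> nc_less m (c ! Suc i) R"
      using less[of "Suc i" k] k by (cases "k = Suc i") auto
    then have "R = c ! Suc i"
      using Ri nc_less_asym by metis
    then show "merges (c ! i) (c ! Suc i)"
      using R by simp
  qed
qed

lemma nc_max_chainsI:
  assumes ne: "c \<noteq> []" and sub: "set c \<subseteq> NC m" and ends: "hd c = NC_bot m" "last c = NC_top m"
    and steps: "successively merges c"
  shows "c \<in> nc_max_chains m"
proof -
  have "successively (nc_less m) c"
    using steps sub by (elim successively_mono) (auto intro: merges_nc_less)
  moreover have "transp (nc_less m)"
    using nc_less_trans by (auto intro: transpI)
  ultimately have sorted: "sorted_wrt (nc_less m) c"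
    by (simp add: successively_conv_sorted_wrt)
  have less: "nc_less m (c ! i) (c ! j)" if "i < j" "j < length c" for i j
    using sorted that by (simp add: sorted_wrt_iff_nth_less)
  have "pred_on.chain (NC m) (nc_less m) (set c)"
    unfolding pred_on.chain_def
  proof (intro conjI ballI)
    fix P Q
    assume "P \<in> set c" "Q \<in> set c"
    then obtain i j where "P = c ! i" "i < length c" "Q = c ! j" "j < length c"
      by (metis in_set_conv_nth)
    then show "(nc_less m)\<^sup>=\<^sup>= P Q \<or> (nc_less m)\<^sup>=\<^sup>= Q P"
      using less by (metis linorder_neqE_nat sup2CI)
  qed (use sub in auto)
  moreover have "Q \<in> set c"
    if chain: "pred_on.chain (NC m) (nc_less m) X" and "set c \<subseteq> X" "Q \<in> X" for X Q
  proof -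
    have Q: "Q \<in> NC m"
      using that by (auto simp: pred_on.chain_def)
    have compare: "same_block (c ! i) \<le> same_block Q \<or> same_block Q \<le> same_block (c ! i)" if "i < length c" for i
      using chain \<open>set c \<subseteq> X\<close> \<open>Q \<in> X\<close> nth_mem[OF that]
      unfolding pred_on.chain_def nc_less_iff by blast
    \<comment> \<open>The last member of the chain below \<open>Q\<close>. Then \<open>Q\<close> is
      squeezed between it and its successor, and \<open>merges_between\<close> leaves only these
      two; without a successor, \<open>Q\<close> is the top.\<close>
    define i where "i = (GREATEST i. i < length c \<and> same_block (c ! i) \<le> same_block Q)"
    have "0 < length c \<and> same_block (c ! 0) \<le> same_block Q"
      using ne ends(1) NC_bot_least[OF Q] by (simp add: hd_conv_nth)
    then have i: "i < length c" "same_block (c ! i) \<le> same_block Q"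
      using GreatestI_nat[of "\<lambda>i. i < length c \<and> same_block (c ! i) \<le> same_block Q" 0 "length c"]
      unfolding i_def by auto
    show ?thesis
    proof (cases "Suc i < length c")
      case True
      have "\<not> same_block (c ! Suc i) \<le> same_block Q"
      proof
        assume "same_block (c ! Suc i) \<le> same_block Q"
        then have "Suc i \<le> (GREATEST i. i < length c \<and> same_block (c ! i) \<le> same_block Q)"
          using True by (intro Greatest_le_nat[of _ _ "length c"]) auto
        then have "Suc i \<le> i"
          unfolding i_def .
        then show False
          by simp
      qed
      then have "same_block Q \<le> same_block (c ! Suc i)"
        using compare[OF True] by blast
      moreover have "c ! i \<in> NC m" "c ! Suc i \<in> NC m" "merges (c ! i) (c ! Suc i)"
        using True sub steps by (auto simp: successively_nth subset_iff)
      ultimately have "Q = c ! i \<or> Q = c ! Suc i"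
        using merges_between i Q by blast
      then show ?thesis
        using True by auto
    next
      case False
      then have "c ! i = NC_top m"
        using i ne ends(2) by (metis Suc_lessI diff_Suc_1 last_conv_nth)
      then have "Q = NC_top m"
        using i Q NC_top_greatest[OF Q] NC_eqI[OF Q NC_top_NC] by simp
      then show ?thesis
        using ends(2) ne last_in_set by metis
    qed
  qed
  ultimately have "pred_on.maxchain (NC m) (nc_less m) (set c)"
    unfolding pred_on.maxchain_def by blast
  with sorted show ?thesis
    by (simp add: nc_max_chains_def)
qed

section \<open>The poset as reachability along good steps\<close>

text \<open>By \<open>cover_label_eq_iff\<close>, for \<open>n \<ge> 1\<close> the excluded merges
  are exactly those with label \<open>n\<close>.\<close>

definition good_steps :: "nat \<Rightarrow> nat set set rel" where
  "good_steps n = {(P, Q). P \<in> NC (Suc n) \<and> Q \<in> NC (Suc n) \<and> merges P Q \<and>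
     \<not> ({Suc n} \<in> P \<and> same_block Q n (Suc n))}"

lemma pf_chains_iff:
  assumes "n \<ge> 1"
  shows "c \<in> pf_chains n (parking_functions_avoiding_max n) \<longleftrightarrow>
    c \<noteq> [] \<and> hd c = NC_bot (Suc n) \<and> last c = NC_top (Suc n) \<and>
    successively (\<lambda>P Q. (P, Q) \<in> good_steps n) c"
proof -
  have labels: "n \<notin> set (chain_labels c) \<longleftrightarrow> successively (\<lambda>P Q. (P, Q) \<in> good_steps n) c"
    if "set c \<subseteq> NC (Suc n)" "successively merges c"
    using that
  proof (induction c rule: induct_list012)
    case (3 P Q c)
    then show ?case
      using cover_label_eq_iff[of P n Q] assms by (auto simp: chain_labels_Cons good_steps_def)
  qed (simp_all add: chain_labels_def)
  show ?thesis
  proof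
    assume c: "c \<in> pf_chains n (parking_functions_avoiding_max n)"
    then have "c \<in> nc_max_chains (Suc n)"
      by (simp add: pf_chains_def)
    from nc_max_chains_steps[OF this] c labels show "c \<noteq> [] \<and> hd c = NC_bot (Suc n) \<and>
        last c = NC_top (Suc n) \<and> successively (\<lambda>P Q. (P, Q) \<in> good_steps n) c"
      by (simp add: pf_chains_def parking_functions_avoiding_max_def)
  next
    assume c: "c \<noteq> [] \<and> hd c = NC_bot (Suc n) \<and> last c = NC_top (Suc n) \<and>
        successively (\<lambda>P Q. (P, Q) \<in> good_steps n) c"
    have merge: "successively merges c"
      using c by (auto elim!: successively_mono simp: good_steps_def)
    have "set c \<subseteq> NC (Suc n)"
      if "c \<noteq> []" "hd c \<in> NC (Suc n)" "successively (\<lambda>P Q. (P, Q) \<in> good_steps n) c" for c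
      using that by (induction c rule: induct_list012) (auto simp: good_steps_def)
    then have "set c \<subseteq> NC (Suc n)"
      using c by simp
    then show "c \<in> pf_chains n (parking_functions_avoiding_max n)"
      using c merge labels nc_max_chainsI chain_labels_parking[OF assms]
      by (simp add: pf_chains_def parking_functions_avoiding_max_def)
  qed
qed

lemma rtrancl_iff_successively:
  "(x, y) \<in> r\<^sup>* \<longleftrightarrow> (\<exists>c. c \<noteq> [] \<and> hd c = x \<and> last c = y \<and> successively (\<lambda>a b. (a, b) \<in> r) c)"
proof
  assume "(x, y) \<in> r\<^sup>*"
  then show "\<exists>c. c \<noteq> [] \<and> hd c = x \<and> last c = y \<and> successively (\<lambda>a b. (a, b) \<in> r) c"
  proof (induction rule: converse_rtrancl_induct)
    case base
    then show ?case
      by (intro exI[of _ "[y]"]) simp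
  next
    case (step x z)
    then obtain c where "c \<noteq> []" "hd c = z" "last c = y" "successively (\<lambda>a b. (a, b) \<in> r) c"
      by blast
    then show ?case
      using step by (intro exI[of _ "x # c"]) (simp add: successively_Cons)
  qed
next
  assume "\<exists>c. c \<noteq> [] \<and> hd c = x \<and> last c = y \<and> successively (\<lambda>a b. (a, b) \<in> r) c"
  then obtain c where "c \<noteq> []" "hd c = x" "last c = y" "successively (\<lambda>a b. (a, b) \<in> r) c"
    by blast
  then show "(x, y) \<in> r\<^sup>*"
  proof (induction c arbitrary: x)
    case (Cons z c)
    then show ?case
      by (cases "c = []") (auto simp: successively_Cons intro: converse_rtrancl_into_rtrancl)
  qed simp
qed

definition on_good_chain :: "nat \<Rightarrow> nat set set \<Rightarrow> bool" where
  "on_good_chain n P \<longleftrightarrow>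
     (NC_bot (Suc n), P) \<in> (good_steps n)\<^sup>* \<and> (P, NC_top (Suc n)) \<in> (good_steps n)\<^sup>*"

text \<open>A chain through \<open>P\<close> splits at \<open>P\<close> into a good path from the
  bottom and one to the top; conversely two such paths concatenate to a chain.\<close>

lemma pf_poset_elems_eq:
  assumes "n \<ge> 1"
  shows "pf_poset_elems n (parking_functions_avoiding_max n) = {P. on_good_chain n P}"
proof (intro equalityI subsetI CollectI)
  fix P
  assume "P \<in> pf_poset_elems n (parking_functions_avoiding_max n)"
  then obtain c where c: "c \<in> pf_chains n (parking_functions_avoiding_max n)" "P \<in> set c"
    by (auto simp: pf_poset_elems_def)
  then obtain xs ys where split: "c = xs @ P # ys"
    by (meson split_list)
  have "successively (\<lambda>P Q. (P, Q) \<in> good_steps n) (xs @ [P])"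
    "successively (\<lambda>P Q. (P, Q) \<in> good_steps n) (P # ys)"
    "hd (xs @ [P]) = NC_bot (Suc n)" "last (P # ys) = NC_top (Suc n)"
    using c(1) unfolding pf_chains_iff[OF assms] split
    by (auto simp: successively_append_iff hd_append split: if_splits)
  then show "on_good_chain n P"
    unfolding on_good_chain_def rtrancl_iff_successively
    by (intro conjI exI[of _ "xs @ [P]"] exI[of _ "P # ys"]) auto
next
  fix P
  assume "P \<in> {P. on_good_chain n P}"
  then obtain c d where
    c: "c \<noteq> []" "hd c = NC_bot (Suc n)" "last c = P" "successively (\<lambda>P Q. (P, Q) \<in> good_steps n) c" and
    d: "d \<noteq> []" "hd d = P" "last d = NC_top (Suc n)" "successively (\<lambda>P Q. (P, Q) \<in> good_steps n) d"
    unfolding on_good_chain_def rtrancl_iff_successively by blast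
  obtain d' where d': "d = P # d'"
    using d by (cases d) auto
  have "c @ d' \<in> pf_chains n (parking_functions_avoiding_max n)"
    unfolding pf_chains_iff[OF assms] using c d
    by (auto simp: d' successively_append_iff successively_Cons last_append split: if_splits)
  moreover have "P \<in> set (c @ d')"
    using c by auto
  ultimately show "P \<in> pf_poset_elems n (parking_functions_avoiding_max n)"
    unfolding pf_poset_elems_def by blast
qed

lemma pf_poset_covers_iff:
  assumes "n \<ge> 1"
  shows "(P, Q) \<in> pf_poset_covers n (parking_functions_avoiding_max n) \<longleftrightarrow>
    on_good_chain n P \<and> on_good_chain n Q \<and> (P, Q) \<in> good_steps n"
proof
  assume "(P, Q) \<in> pf_poset_covers n (parking_functions_avoiding_max n)"
  then obtain c i where c: "c \<in> pf_chains n (parking_functions_avoiding_max n)"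
      "P = c ! i" "Q = c ! Suc i" "Suc i < length c"
    by (auto simp: pf_poset_covers_def)
  then have "(P, Q) \<in> good_steps n"
    unfolding pf_chains_iff[OF assms] using successively_nth by fastforce
  moreover have "{P, Q} \<subseteq> pf_poset_elems n (parking_functions_avoiding_max n)"
    unfolding pf_poset_elems_def using c by (auto intro!: bexI[of _ c])
  ultimately show "on_good_chain n P \<and> on_good_chain n Q \<and> (P, Q) \<in> good_steps n"
    unfolding pf_poset_elems_eq[OF assms] by simp
next
  assume *: "on_good_chain n P \<and> on_good_chain n Q \<and> (P, Q) \<in> good_steps n"
  then obtain c d where
    c: "c \<noteq> []" "hd c = NC_bot (Suc n)" "last c = P" "successively (\<lambda>P Q. (P, Q) \<in> good_steps n) c" and
    d: "d \<noteq> []" "hd d = Q" "last d = NC_top (Suc n)" "successively (\<lambda>P Q. (P, Q) \<in> good_steps n) d"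
    unfolding on_good_chain_def rtrancl_iff_successively by blast
  have "c @ d \<in> pf_chains n (parking_functions_avoiding_max n)"
    unfolding pf_chains_iff[OF assms] using c d *
    by (auto simp: successively_append_iff)
  moreover have "(c @ d) ! (length c - 1) = P" "(c @ d) ! Suc (length c - 1) = Q"
    using c d by (auto simp: nth_append last_conv_nth hd_conv_nth)
  ultimately show "(P, Q) \<in> pf_poset_covers n (parking_functions_avoiding_max n)"
    unfolding pf_poset_covers_def using c(1) d(1)
    by (intro CollectI exI[of _ "c @ d"] exI[of _ "length c - 1"]) (auto simp: Suc_less_eq2)
qed

text \<open>A good path between two partitions on good chains stays among such partitions, so all
  its steps are covers of the poset.\<close>

lemma pf_poset_le_iff:
  assumes "n \<ge> 1"
  shows "pf_poset_le n (parking_functions_avoiding_max n) P Q \<longleftrightarrow>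
    on_good_chain n P \<and> on_good_chain n Q \<and> (P, Q) \<in> (good_steps n)\<^sup>*"
proof -
  let ?C = "pf_poset_covers n (parking_functions_avoiding_max n)"
  have "(P, Q) \<in> ?C\<^sup>* \<longleftrightarrow> (P, Q) \<in> (good_steps n)\<^sup>*" if good: "on_good_chain n P" "on_good_chain n Q"
  proof
    show "(P, Q) \<in> ?C\<^sup>* \<Longrightarrow> (P, Q) \<in> (good_steps n)\<^sup>*"
      using pf_poset_covers_iff[OF assms] by (auto elim!: rtrancl_mono [THEN subsetD, rotated])
  next
    assume "(P, Q) \<in> (good_steps n)\<^sup>*"
    then show "(P, Q) \<in> ?C\<^sup>*"
      using good(1)
    proof (induction rule: converse_rtrancl_induct)
      case (step P R)
      then have "on_good_chain n R"
        using good(2) unfolding on_good_chain_def by (meson rtrancl.rtrancl_into_rtrancl rtrancl_trans)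
      then show ?case
        using step pf_poset_covers_iff[OF assms] by (meson converse_rtrancl_into_rtrancl)
    qed simp
  qed
  then show ?thesis
    unfolding pf_poset_le_def pf_poset_elems_eq[OF assms] by auto
qed

section \<open>Good paths and atoms\<close>

lemma singleton_block_iff:
  assumes P: "P \<in> NC (Suc n)"
  shows "{Suc n} \<in> P \<longleftrightarrow> \<not> (\<exists>d\<le>n. same_block P d (Suc n))"
proof
  assume "{Suc n} \<in> P"
  then show "\<not> (\<exists>d\<le>n. same_block P d (Suc n))"
    using same_block_iff'[OF NC_partition[OF P], of "{Suc n}" "Suc n"] by auto
next
  assume free: "\<not> (\<exists>d\<le>n. same_block P d (Suc n))"
  obtain B where B: "B \<in> P" "Suc n \<in> B"
    using same_block_refl[OF NC_partition[OF P], of "Suc n"] by (auto simp: same_block_def)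
  have "d = Suc n" if "d \<in> B" for d
  proof -
    have "d \<le> Suc n"
      using NC_block(1)[OF P B(1)] that by auto
    moreover have "same_block P d (Suc n)"
      using B that by (auto simp: same_block_def)
    ultimately show ?thesis
      using free by (metis le_SucE)
  qed
  then have "B = {Suc n}"
    using B by blast
  with B show "{Suc n} \<in> P"
    by simp
qed

lemma good_steps_iff:
  "(P, Q) \<in> good_steps n \<longleftrightarrow> P \<in> NC (Suc n) \<and> Q \<in> NC (Suc n) \<and> merges P Q \<and>
     (same_block Q n (Suc n) \<longrightarrow> (\<exists>d\<le>n. same_block P d (Suc n)))"
  using singleton_block_iff unfolding good_steps_def by auto

lemma good_path_le:
  assumes "(P, Q) \<in> (good_steps n)\<^sup>*"
  shows "same_block P \<le> same_block Q"
  using assms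
proof (induction rule: rtrancl_induct)
  case (step Q R)
  then have "same_block Q \<le> same_block R"
    by (intro merges_same_block_le) (simp add: good_steps_iff)
  with step show ?case
    by (meson order_trans)
qed simp

lemma good_path_antisym:
  assumes "P \<in> NC (Suc n)" "Q \<in> NC (Suc n)" "(P, Q) \<in> (good_steps n)\<^sup>*" "(Q, P) \<in> (good_steps n)\<^sup>*"
  shows "P = Q"
  using assms good_path_le NC_eqI by (metis order_antisym)

text \<open>Any merge \<open>R\<close> of \<open>P\<close> that refines \<open>Q\<close> is a good
  first step: if \<open>R\<close> joins \<open>n\<close> and \<open>Suc n\<close>, so does
  \<open>Q\<close>, and the last hypothesis says that \<open>Suc n\<close> is not alone in
  \<open>P\<close>. That hypothesis persists for the coarser \<open>R\<close>, so induction on the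
  number of blocks applies.\<close>

lemma good_pathI:
  assumes "P \<in> NC (Suc n)" "Q \<in> NC (Suc n)" "same_block P \<le> same_block Q"
    and "same_block Q n (Suc n) \<Longrightarrow> \<exists>d\<le>n. same_block P d (Suc n)"
  shows "(P, Q) \<in> (good_steps n)\<^sup>*"
  using assms
proof (induction "card P" arbitrary: P rule: less_induct)
  case less
  show ?case
  proof (cases "P = Q")
    case False
    then obtain R where R: "R \<in> NC (Suc n)" "merges P R" "same_block R \<le> same_block Q"
      using merge_exists[OF less.prems(1-3)] by blast
    have PR: "same_block P \<le> same_block R"
      using R(2) by (rule merges_same_block_le)
    have "(P, R) \<in> good_steps n"
      unfolding good_steps_iff using R less.prems by blast
    moreover have "(R, Q) \<in> (good_steps n)\<^sup>*"
    proof (rule less.hyps)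
      show "card R < card P"
        using merges_card[OF less.prems(1) R(2)] by simp
      show "\<exists>d\<le>n. same_block R d (Suc n)" if "same_block Q n (Suc n)"
        using less.prems(4)[OF that] PR by blast
    qed (use R less.prems in auto)
    ultimately show ?thesis
      by (rule converse_rtrancl_into_rtrancl)
  qed simp
qed

text \<open>
  When the block \<open>{n + 1}\<close> is merged along a good step, the other block does not contain \<open>n\<close>, and
  since partitions are noncrossing it starts below the block of \<open>n\<close>.
\<close>

lemma good_path_invariant:
  assumes "(P, Q) \<in> (good_steps n)\<^sup>*"
    and "\<not> (\<exists>d\<le>n. same_block P d (Suc n))" "same_block P i n" "same_block Q n (Suc n)"
  shows "\<exists>d<i. same_block Q d (Suc n)"
  using assms
proof (induction rule: converse_rtrancl_induct)
  case base
  then show ?case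
    by blast
next
  case (step P R)
  have R: "R \<in> NC (Suc n)"
    using step.hyps(1) by (simp add: good_steps_iff)
  note tr = same_block_trans[OF NC_partition[OF R]] and sy = same_block_sym[of R]
  have PR: "same_block P \<le> same_block R"
    using step.hyps(1) by (intro merges_same_block_le) (simp add: good_steps_iff)
  have iR: "same_block R i n"
    using step.prems(2) PR by blast
  show ?case
  proof (cases "\<exists>d\<le>n. same_block R d (Suc n)")
    case False
    then show ?thesis
      using step iR by blast
  next
    case True
    then obtain d where d: "d \<le> n" "same_block R d (Suc n)"
      by blast
    have nR: "\<not> same_block R n (Suc n)"
      using step.hyps(1) step.prems(1) by (auto simp: good_steps_iff)
    have "\<not> same_block R i d"
      using nR d(2) iR tr sy by blast
    moreover have "d \<noteq> n" "d \<noteq> i"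
      using nR d(2) iR tr sy by blast+
    ultimately have "d < i"
      using NC_noncrossing[OF R, of i d n "Suc n"] iR d by (meson lessI linorder_neqE_nat order_le_less)
    then show ?thesis
      using good_path_le[OF step.hyps(2)] d by blast
  qed
qed

lemma same_block_leI:
  assumes P: "P \<in> NC m" and Q: "Q \<in> NC m"
    and less: "\<And>p q. 1 \<le> p \<Longrightarrow> p < q \<Longrightarrow> q \<le> m \<Longrightarrow> same_block P p q \<Longrightarrow> same_block Q p q"
  shows "same_block P \<le> same_block Q"
proof (rule predicate2I)
  fix p q
  assume pq: "same_block P p q"
  then have mem: "1 \<le> p" "p \<le> m" "1 \<le> q" "q \<le> m"
    using same_block_mem[OF NC_partition[OF P]] by auto
  consider "p < q" | "p = q" | "q < p"
    by linarith
  then show "same_block Q p q"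
  proof cases
    case 1
    then show ?thesis
      using less pq mem by blast
  next
    case 2
    then show ?thesis
      using mem same_block_refl[OF NC_partition[OF Q]] by simp
  next
    case 3
    then show ?thesis
      using less[of q p] pq mem same_block_sym by metis
  qed
qed

section \<open>Which partitions lie on good chains\<close>

lemma on_good_chain_NC:
  assumes "on_good_chain n P"
  shows "P \<in> NC (Suc n)"
proof -
  have "(NC_bot (Suc n), P) \<in> (good_steps n)\<^sup>*"
    using assms by (simp add: on_good_chain_def)
  then show ?thesis
    by (induction rule: rtrancl_induct) (auto simp: good_steps_iff)
qed

text \<open>Necessity is \<open>good_path_invariant\<close> twice: on the path from the bottom with
  \<open>i = n\<close>, and on the path to the top with \<open>i = 1\<close>, where no smaller
  \<open>d\<close> exists. For sufficiency, an intermediate partition \<open>W\<close> attaches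
  \<open>Suc n\<close> to a block without \<open>n\<close> where needed.\<close>

lemma on_good_chain_iff:
  assumes "n \<ge> 2"
  shows "on_good_chain n P \<longleftrightarrow> P \<in> NC (Suc n) \<and>
    (same_block P n (Suc n) \<longrightarrow> (\<exists>d<n. same_block P d (Suc n))) \<and>
    (same_block P 1 n \<longrightarrow> (\<exists>d\<le>n. same_block P d (Suc n)))"
proof (intro iffI conjI impI; (elim conjE)?)
  assume P: "on_good_chain n P"
  then show NC: "P \<in> NC (Suc n)"
    by (rule on_good_chain_NC)
  show "\<exists>d<n. same_block P d (Suc n)" if "same_block P n (Suc n)"
    using P that assms by (intro good_path_invariant[of "NC_bot (Suc n)"]) (auto simp: on_good_chain_def)
  show "\<exists>d\<le>n. same_block P d (Suc n)" if "same_block P 1 n"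
  proof (rule ccontr)
    assume "\<not> (\<exists>d\<le>n. same_block P d (Suc n))"
    then have "\<exists>d<1. same_block (NC_top (Suc n)) d (Suc n)"
      using P that assms by (intro good_path_invariant[of P]) (auto simp: on_good_chain_def)
    then show False
      by simp
  qed
next
  assume P: "P \<in> NC (Suc n)"
    and n: "same_block P n (Suc n) \<longrightarrow> (\<exists>d<n. same_block P d (Suc n))"
    and one: "same_block P 1 n \<longrightarrow> (\<exists>d\<le>n. same_block P d (Suc n))"
  note tr = same_block_trans[OF NC_partition[OF P]] and sy = same_block_sym[of P]
  have mem: "1 \<le> i" "i \<le> Suc n" "1 \<le> j" "j \<le> Suc n" if "same_block P i j" for i j
    using that same_block_mem[OF NC_partition[OF P]] by auto
  show "on_good_chain n P"
    unfolding on_good_chain_def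
  proof
    show "(NC_bot (Suc n), P) \<in> (good_steps n)\<^sup>*"
    proof (cases "same_block P n (Suc n)")
      case False
      then show ?thesis
        using P NC_bot_least by (intro good_pathI) auto
    next
      case True
      then obtain d where d: "d < n" "same_block P d (Suc n)"
        using n by blast
      \<comment> \<open>Attach \<open>Suc n\<close> to \<open>d\<close> first; after that
        \<open>Suc n\<close> is no singleton and every merge is good.\<close>
      define W where "W = kernel_partition (Suc n) (id(Suc n := d))"
      have W: "W \<in> NC (Suc n)"
        unfolding W_def by (rule kernel_partition_NC) (auto split: if_splits)
      have "(NC_bot (Suc n), W) \<in> (good_steps n)\<^sup>*"
        using W NC_bot_least d by (intro good_pathI) (auto simp: W_def)
      moreover have "same_block W \<le> same_block P"
        using d(1) by (intro same_block_leI[OF W P]) (auto simp: W_def d(2) split: if_splits)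
      then have "(W, P) \<in> (good_steps n)\<^sup>*"
        using W P d mem[OF d(2)] by (intro good_pathI exI[of _ d]) (auto simp: W_def)
      ultimately show ?thesis
        by (rule rtrancl_trans)
    qed
  next
    show "(P, NC_top (Suc n)) \<in> (good_steps n)\<^sup>*"
    proof (cases "\<exists>d\<le>n. same_block P d (Suc n)")
      case True
      then show ?thesis
        using P NC_top_greatest by (intro good_pathI) auto
    next
      case False
      \<comment> \<open>\<open>W\<close> adds \<open>Suc n\<close>, here a singleton of
        \<open>P\<close>, to the block of \<open>1\<close>. These points are neighbours on the
        circle, so nothing crosses, and by \<open>one\<close> that block does not contain
        \<open>n\<close>.\<close>
      define r where "r i = (if i = Suc n then 1 else i)" for i
      define W where "W = kernel_partition (Suc n) (\<lambda>i. {j. same_block P (r i) j})"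
      have r: "1 \<le> i \<Longrightarrow> i \<le> Suc n \<Longrightarrow> r i \<in> {1..Suc n}" for i
        by (auto simp: r_def)
      have class_eq: "{j. same_block P x j} = {j. same_block P y j} \<longleftrightarrow> same_block P x y"
        if "x \<in> {1..Suc n}" "y \<in> {1..Suc n}" for x y
        using that same_block_refl[OF NC_partition[OF P]] tr sy by blast
      have W_iff: "same_block W i j \<longleftrightarrow> i \<in> {1..Suc n} \<and> j \<in> {1..Suc n} \<and> same_block P (r i) (r j)" for i j
        unfolding W_def same_block_kernel_partition using class_eq[OF r r, of i j] by auto
      have W: "W \<in> NC (Suc n)"
        unfolding NC_iff
      proof (intro conjI allI impI; (elim conjE)?)
        show "partition_on {1..Suc n} W"
          unfolding W_def by (rule partition_on_kernel_partition)
        fix a b c d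
        assume ord: "a < b" "b < c" "c < d" and ac: "same_block W a c" and bd: "same_block W b d"
        have in_range: "1 \<le> a" "d \<le> Suc n"
          using ac bd by (auto simp: W_iff)
        then have ac': "same_block P a c" and rab: "r a = a" "r b = b"
          using ac ord by (auto simp: W_iff r_def split: if_splits)
        have bd': "same_block P b (r d)"
          using bd ord in_range by (auto simp: W_iff r_def split: if_splits)
        have "same_block P a b"
        proof (cases "d = Suc n")
          case False
          then show ?thesis
            using NC_noncrossing[OF P ord ac'] bd' by (simp add: r_def)
        next
          case True
          then have "same_block P 1 b"
            using bd' sy by (simp add: r_def)
          then show ?thesis
            using NC_noncrossing[OF P, of 1 a b c] ord ac' in_range tr sy
            by (metis le_neq_implies_less)
        qed
        then show "same_block W a b"
          using ord in_range rab by (simp add: W_iff)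
      qed
      have "same_block P \<le> same_block W"
        using False by (intro same_block_leI[OF P W]) (auto simp: W_iff r_def less_Suc_eq_le)
      moreover have "\<not> same_block W n (Suc n)"
        using False one sy assms by (auto simp: W_iff r_def)
      ultimately have "(P, W) \<in> (good_steps n)\<^sup>*"
        using P W by (intro good_pathI) auto
      moreover have "same_block W 1 (Suc n)"
        using assms same_block_refl[OF NC_partition[OF P], of 1] by (auto simp: W_iff r_def)
      then have "(W, NC_top (Suc n)) \<in> (good_steps n)\<^sup>*"
        using W NC_top_greatest assms by (intro good_pathI exI[of _ 1]) auto
      ultimately show ?thesis
        by (rule rtrancl_trans)
    qed
  qed
qed

section \<open>Atoms and the elements above them\<close>

definition pair_partition :: "nat \<Rightarrow> nat \<Rightarrow> nat \<Rightarrow> nat set set" where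
  "pair_partition n i j = kernel_partition (Suc n) (id(j := i))"

text \<open>For \<open>n \<ge> 2\<close> the two excluded pairs are those that violate
  \<open>on_good_chain_iff\<close>: \<open>(n, Suc n)\<close> its first condition and
  \<open>(1, n)\<close> its second.\<close>

definition atom_index :: "nat \<Rightarrow> nat \<Rightarrow> nat \<Rightarrow> bool" where
  "atom_index n i j \<longleftrightarrow> 1 \<le> i \<and> i < j \<and> j \<le> Suc n \<and> (i, j) \<noteq> (1, n) \<and> (i, j) \<noteq> (n, Suc n)"

lemma same_block_pair_partition:
  "i < j \<Longrightarrow> same_block (pair_partition n i j) x y \<longleftrightarrow>
     x \<in> {1..Suc n} \<and> y \<in> {1..Suc n} \<and> (x = y \<or> x = i \<and> y = j \<or> x = j \<and> y = i)"
  by (auto simp: pair_partition_def)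

lemma pair_partition_NC: "i < j \<Longrightarrow> pair_partition n i j \<in> NC (Suc n)"
  unfolding pair_partition_def by (rule kernel_partition_NC) (auto split: if_splits)

lemma pair_partition_eq_iff:
  assumes "1 \<le> i" "i < j" "j \<le> Suc n" "1 \<le> i'" "i' < j'" "j' \<le> Suc n"
  shows "pair_partition n i j = pair_partition n i' j' \<longleftrightarrow> i = i' \<and> j = j'"
proof
  assume "pair_partition n i j = pair_partition n i' j'"
  then have "same_block (pair_partition n i' j') i j"
    using assms same_block_pair_partition[of i j n i j] by simp
  then show "i = i' \<and> j = j'"
    using assms by (auto simp: same_block_pair_partition)
qed simp

lemma pair_partition_le:
  assumes "i < j" "P \<in> NC (Suc n)" "same_block P i j"
  shows "same_block (pair_partition n i j) \<le> same_block P"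
  using assms by (intro same_block_leI[OF pair_partition_NC]) (auto simp: same_block_pair_partition)

lemma atom_on_good_chain:
  assumes "n \<ge> 2" "atom_index n i j"
  shows "on_good_chain n (pair_partition n i j)"
  using assms pair_partition_NC[of i j n]
  by (auto simp: on_good_chain_iff atom_index_def same_block_pair_partition)

text \<open>The extra condition for \<open>j = n\<close> comes from
  \<open>good_path_invariant\<close>. For sufficiency the delicate case is that \<open>P\<close>
  joins \<open>n\<close> and \<open>Suc n\<close> while the atom leaves \<open>Suc n\<close> alone:
  the path then goes through a partition \<open>W\<close> that attaches \<open>Suc n\<close> to some
  \<open>e < n\<close>, apart from \<open>n\<close>.\<close>

lemma atom_le_iff:
  assumes "n \<ge> 2" and P: "on_good_chain n P" and ij: "atom_index n i j"
  shows "(pair_partition n i j, P) \<in> (good_steps n)\<^sup>* \<longleftrightarrow>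
    same_block P i j \<and> (j = n \<and> same_block P n (Suc n) \<longrightarrow> (\<exists>d<i. same_block P d (Suc n)))"
    (is "?le \<longleftrightarrow> ?same \<and> ?low")
proof
  assume path: ?le
  have idx: "1 \<le> i" "i < j" "j \<le> Suc n" "(i, j) \<noteq> (n, Suc n)"
    using ij by (auto simp: atom_index_def)
  have ?same
    using good_path_le[OF path] idx same_block_pair_partition[OF idx(2), of n i j] by auto
  moreover have ?low
  proof
    assume "j = n \<and> same_block P n (Suc n)"
    then show "\<exists>d<i. same_block P d (Suc n)"
      using idx by (intro good_path_invariant[OF path]) (auto simp: same_block_pair_partition)
  qed
  ultimately show "?same \<and> ?low"
    by blast
next
  assume *: "?same \<and> ?low"
  have idx: "1 \<le> i" "i < j" "j \<le> Suc n"
    using ij by (auto simp: atom_index_def)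
  have NC: "P \<in> NC (Suc n)"
    using P by (rule on_good_chain_NC)
  note tr = same_block_trans[OF NC_partition[OF NC]] and sy = same_block_sym[of P]
  have le: "same_block (pair_partition n i j) \<le> same_block P"
    using * idx NC by (intro pair_partition_le) auto
  consider "\<not> same_block P n (Suc n)" | "j = Suc n" "i \<le> n" | "same_block P n (Suc n)" "j \<le> n"
    using idx by linarith
  then show ?le
  proof cases
    case 1
    then show ?thesis
      using le NC idx by (intro good_pathI pair_partition_NC) auto
  next
    case 2
    then show ?thesis
      using le NC idx
      by (intro good_pathI pair_partition_NC exI[of _ i]) (auto simp: same_block_pair_partition)
  next
    case 3
    obtain d where d: "d < n" "same_block P d (Suc n)" "j = n \<longrightarrow> d < i"
    proof (cases "j = n")
      case True
      then show ?thesis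
        using * 3 idx that by (metis less_trans)
    next
      case False
      then show ?thesis
        using P 3 that \<open>n \<ge> 2\<close> by (auto simp: on_good_chain_iff)
    qed
    have "d \<ge> 1"
      using same_block_mem[OF NC_partition[OF NC] d(2)] by simp
    \<comment> \<open>For \<open>j = n\<close>, taking \<open>e = i\<close> would join
      \<open>n\<close> and \<open>Suc n\<close> in \<open>W\<close>, so the given
      \<open>d < i\<close> is used. Otherwise \<open>i\<close> is preferred when it lies in the
      block of \<open>Suc n\<close>, because \<open>d\<close> could then fall between
      \<open>i\<close> and \<open>j\<close> or equal \<open>j\<close>; when it does not, noncrossing
      keeps \<open>d\<close> outside.\<close>
    define e where "e = (if same_block P i (Suc n) \<and> j \<noteq> n then i else d)"
    have e: "e < n" "same_block P e (Suc n)" "e \<ge> 1" "e \<noteq> j" "j = n \<longrightarrow> e < i" "e = i \<or> e < i \<or> j < e"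
    proof -
      show "e < n" "same_block P e (Suc n)" "e \<ge> 1" "j = n \<longrightarrow> e < i"
        using d idx 3 \<open>d \<ge> 1\<close> by (auto simp: e_def)
      have "d < i \<or> j < d" if "\<not> same_block P i (Suc n)"
      proof -
        have "d \<noteq> i" "d \<noteq> j" "\<not> same_block P i d"
          using that d(2) * tr sy by blast+
        then show ?thesis
          using NC_noncrossing[OF NC, of i d j "Suc n"] d(2) * 3
          by (meson le_imp_less_Suc linorder_neqE_nat)
      qed
      then show "e \<noteq> j" "e = i \<or> e < i \<or> j < e"
        using d(3) idx by (auto simp: e_def)
    qed
    define W where "W = kernel_partition (Suc n) (id(j := i, Suc n := e))"
    have W: "W \<in> NC (Suc n)"
      unfolding W_def using e idx 3 by (intro kernel_partition_NC) (auto split: if_splits)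
    have nW: "\<not> same_block W n (Suc n)"
      using e idx by (auto simp: W_def)
    have "(pair_partition n i j, W) \<in> (good_steps n)\<^sup>*"
      using nW W idx 3 by (intro good_pathI pair_partition_NC pair_partition_le) (auto simp: W_def)
    moreover have "same_block W \<le> same_block P"
    proof (rule same_block_leI[OF W NC])
      fix p q
      assume "1 \<le> p" "p < q" "q \<le> Suc n" "same_block W p q"
      then have "p = i \<and> q = j \<or> p = e \<and> q = Suc n \<or> p = j \<and> q = Suc n \<and> e = i"
        using e idx 3 by (auto simp: W_def split: if_splits)
      then show "same_block P p q"
        using * e tr sy by metis
    qed
    then have "(W, P) \<in> (good_steps n)\<^sup>*"
      using W NC e idx 3 by (intro good_pathI exI[of _ e]) (auto simp: W_def)
    ultimately show ?thesis
      by (rule rtrancl_trans)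
  qed
qed

section \<open>Spokes, and the atoms below a partition\<close>

definition atoms :: "nat \<Rightarrow> nat set set set" where
  "atoms n = {pair_partition n i j | i j. atom_index n i j}"

definition atoms_below :: "nat \<Rightarrow> nat set set \<Rightarrow> nat set set set" where
  "atoms_below n P = {e \<in> atoms n. (e, P) \<in> (good_steps n)\<^sup>*}"

definition spoke :: "nat \<Rightarrow> nat \<Rightarrow> nat set set" where
  "spoke n b = pair_partition n b (Suc n)"

definition spokes :: "nat \<Rightarrow> nat set set set" where
  "spokes n = spoke n ` {1..<n}"

lemma spoke_index: "n \<ge> 2 \<Longrightarrow> b \<in> {1..<n} \<Longrightarrow> atom_index n b (Suc n)"
  by (auto simp: atom_index_def)

lemma pair_partition_atom: "atom_index n i j \<Longrightarrow> pair_partition n i j \<in> atoms n"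
  by (auto simp: atoms_def)

lemma spoke_atom: "n \<ge> 2 \<Longrightarrow> b \<in> {1..<n} \<Longrightarrow> spoke n b \<in> atoms n"
  unfolding spoke_def by (intro pair_partition_atom spoke_index)

lemma spokes_subset: "n \<ge> 2 \<Longrightarrow> spokes n \<subseteq> atoms n"
  by (auto simp: spokes_def intro!: spoke_atom)

lemma spoke_mem: "b \<in> {1..<n} \<Longrightarrow> spoke n b \<in> spokes n"
  by (simp add: spokes_def)

lemma atom_mem_spokes_iff:
  assumes "atom_index n i j"
  shows "pair_partition n i j \<in> spokes n \<longleftrightarrow> j = Suc n"
proof
  assume "pair_partition n i j \<in> spokes n"
  then obtain b where "b \<in> {1..<n}" "pair_partition n i j = pair_partition n b (Suc n)"
    by (auto simp: spokes_def spoke_def)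
  then show "j = Suc n"
    using assms by (subst (asm) pair_partition_eq_iff) (auto simp: atom_index_def)
next
  assume "j = Suc n"
  then show "pair_partition n i j \<in> spokes n"
    using assms by (auto simp: spokes_def spoke_def atom_index_def)
qed

lemma spoke_eq_iff: "b \<in> {1..<n} \<Longrightarrow> c \<in> {1..<n} \<Longrightarrow> spoke n b = spoke n c \<longleftrightarrow> b = c"
  unfolding spoke_def by (subst pair_partition_eq_iff) auto

lemma spoke_le_iff:
  assumes "n \<ge> 2" "on_good_chain n P" "b \<in> {1..<n}"
  shows "(spoke n b, P) \<in> (good_steps n)\<^sup>* \<longleftrightarrow> same_block P b (Suc n)"
  unfolding spoke_def using atom_le_iff[OF assms(1,2) spoke_index[OF assms(1,3)]] assms by auto

lemma non_spokeE:
  assumes "e \<in> atoms n" "e \<notin> spokes n"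
  obtains i j where "e = pair_partition n i j" "atom_index n i j" "j \<le> n"
  using assms atom_mem_spokes_iff that unfolding atoms_def
  by (auto simp: le_Suc_eq atom_index_def)

lemma atoms_on_good_chain: "n \<ge> 2 \<Longrightarrow> e \<in> atoms n \<Longrightarrow> on_good_chain n e"
  by (auto simp: atoms_def atom_on_good_chain)

lemma NC_bot_on_good_chain: "n \<ge> 2 \<Longrightarrow> on_good_chain n (NC_bot (Suc n))"
  by (simp add: on_good_chain_iff)

text \<open>The point is that \<open>1\<close> and \<open>n\<close> are apart as well: otherwise
  membership gives a \<open>d\<close> in the block of \<open>Suc n\<close>, and noncrossing for
  \<open>1 < d < n < Suc n\<close> would join \<open>n\<close> and \<open>Suc n\<close>.\<close>

lemma atom_below_pair:
  assumes n: "n \<ge> 2" and P: "on_good_chain n P" and nn: "\<not> same_block P n (Suc n)"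
    and pq: "p < q" "same_block P p q"
  shows "atom_index n p q" "(pair_partition n p q, P) \<in> (good_steps n)\<^sup>*"
proof -
  have NC: "P \<in> NC (Suc n)"
    using P by (rule on_good_chain_NC)
  note tr = same_block_trans[OF NC_partition[OF NC]] and sy = same_block_sym[of P]
  have mem: "1 \<le> p" "q \<le> Suc n"
    using same_block_mem[OF NC_partition[OF NC] pq(2)] by auto
  have "\<not> same_block P 1 n"
  proof
    assume one: "same_block P 1 n"
    then obtain d where d: "d \<le> n" "same_block P d (Suc n)"
      using P n by (auto simp: on_good_chain_iff)
    have "d \<noteq> n" "d \<noteq> 1"
      using d one nn tr sy by blast+
    moreover have "d \<ge> 1"
      using same_block_mem[OF NC_partition[OF NC] d(2)] by simp
    ultimately have "same_block P 1 d"
      using d by (intro NC_noncrossing[OF NC _ _ _ one d(2)]) auto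
    then show False
      using d one nn tr sy by blast
  qed
  then show idx: "atom_index n p q"
    using mem pq nn by (auto simp: atom_index_def le_Suc_eq)
  show "(pair_partition n p q, P) \<in> (good_steps n)\<^sup>*"
    using pq nn by (auto simp: atom_le_iff[OF n P idx])
qed

lemma atom_below_exists:
  assumes n: "n \<ge> 2" and P: "on_good_chain n P" and "P \<noteq> NC_bot (Suc n)"
  obtains e where "e \<in> atoms n" "(e, P) \<in> (good_steps n)\<^sup>*"
proof (cases "same_block P n (Suc n)")
  case True
  then obtain d where d: "d < n" "same_block P d (Suc n)"
    using P n by (auto simp: on_good_chain_iff)
  moreover have "d \<ge> 1"
    using same_block_mem[OF NC_partition[OF on_good_chain_NC[OF P]] d(2)] by simp
  ultimately show ?thesis
    using that[of "spoke n d"] spoke_atom[OF n] spoke_le_iff[OF n P] by auto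
next
  case False
  have NC: "P \<in> NC (Suc n)"
    using P by (rule on_good_chain_NC)
  have "\<not> same_block P \<le> same_block (NC_bot (Suc n))"
    using \<open>P \<noteq> NC_bot (Suc n)\<close> NC NC_bot_least NC_eqI by (metis NC_bot_NC order_antisym)
  then obtain p q where "p < q" "same_block P p q"
    using same_block_leI[OF NC NC_bot_NC] by blast
  then show ?thesis
    using that atom_below_pair[OF n P False] pair_partition_atom by blast
qed

lemma below_pair_partition:
  assumes "i < j" "Q \<in> NC (Suc n)" "same_block Q \<le> same_block (pair_partition n i j)"
  shows "Q = NC_bot (Suc n) \<or> Q = pair_partition n i j"
proof (cases "same_block Q i j")
  case True
  then have "same_block (pair_partition n i j) \<le> same_block Q"
    using assms by (intro pair_partition_le)
  then show ?thesis
    using assms by (metis NC_eqI order_antisym pair_partition_NC)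
next
  case False
  have "same_block Q \<le> same_block (NC_bot (Suc n))"
  proof (rule same_block_leI[OF assms(2) NC_bot_NC])
    fix p q
    assume pq: "p < q" "same_block Q p q"
    then have "same_block (pair_partition n i j) p q"
      using assms(3) by blast
    then show "same_block (NC_bot (Suc n)) p q"
      using pq False assms(1) by (auto simp: same_block_pair_partition)
  qed
  then show ?thesis
    using assms(2) NC_bot_least by (metis NC_eqI NC_bot_NC order_antisym)
qed

lemma atom_ne_bot: "e \<in> atoms n \<Longrightarrow> e \<noteq> NC_bot (Suc n)"
proof
  assume "e \<in> atoms n" and bot: "e = NC_bot (Suc n)"
  then obtain i j where ij: "e = pair_partition n i j" "atom_index n i j"
    by (auto simp: atoms_def)
  then have "same_block e i j" "i < j"
    by (auto simp: atom_index_def same_block_pair_partition)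
  then show False
    by (simp add: bot)
qed

text \<open>Describes the atoms by the order alone, so that automorphisms permute them.\<close>

lemma atoms_iff_minimal:
  assumes n: "n \<ge> 2"
  shows "e \<in> atoms n \<longleftrightarrow> on_good_chain n e \<and> e \<noteq> NC_bot (Suc n) \<and>
    (\<forall>Q. on_good_chain n Q \<and> (Q, e) \<in> (good_steps n)\<^sup>* \<longrightarrow> Q = NC_bot (Suc n) \<or> Q = e)"
proof
  assume e: "e \<in> atoms n"
  then obtain i j where ij: "e = pair_partition n i j" "atom_index n i j"
    by (auto simp: atoms_def)
  then have "i < j"
    by (simp add: atom_index_def)
  have "Q = NC_bot (Suc n) \<or> Q = e" if "on_good_chain n Q" "(Q, e) \<in> (good_steps n)\<^sup>*" for Q
    using below_pair_partition[OF \<open>i < j\<close> on_good_chain_NC[OF that(1)]] good_path_le[OF that(2)] ij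
    by blast
  then show "on_good_chain n e \<and> e \<noteq> NC_bot (Suc n) \<and>
      (\<forall>Q. on_good_chain n Q \<and> (Q, e) \<in> (good_steps n)\<^sup>* \<longrightarrow> Q = NC_bot (Suc n) \<or> Q = e)"
    using atoms_on_good_chain[OF n e] atom_ne_bot[OF e] by blast
next
  assume *: "on_good_chain n e \<and> e \<noteq> NC_bot (Suc n) \<and>
      (\<forall>Q. on_good_chain n Q \<and> (Q, e) \<in> (good_steps n)\<^sup>* \<longrightarrow> Q = NC_bot (Suc n) \<or> Q = e)"
  then obtain a where a: "a \<in> atoms n" "(a, e) \<in> (good_steps n)\<^sup>*"
    using atom_below_exists[OF n] by blast
  then have "on_good_chain n a" "a \<noteq> NC_bot (Suc n)"
    using n atoms_on_good_chain atom_ne_bot by blast+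
  with * a show "e \<in> atoms n"
    by blast
qed

text \<open>With \<open>n\<close> and \<open>Suc n\<close> apart, every pair inside a block of
  \<open>P\<close> is an atom below \<open>P\<close>, so \<open>P\<close> is the join of its atoms
  with respect to refinement.\<close>

lemma same_block_le_if_atoms_below:
  assumes n: "n \<ge> 2" and P: "on_good_chain n P" and Q: "Q \<in> NC (Suc n)"
    and nn: "\<not> same_block P n (Suc n)"
    and le: "\<And>e. e \<in> atoms_below n P \<Longrightarrow> same_block e \<le> same_block Q"
  shows "same_block P \<le> same_block Q"
proof (rule same_block_leI[OF on_good_chain_NC[OF P] Q])
  fix p q
  assume pq: "p < q" "same_block P p q"
  then have idx: "atom_index n p q" and "(pair_partition n p q, P) \<in> (good_steps n)\<^sup>*"
    using atom_below_pair[OF n P nn] by auto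
  then have "same_block (pair_partition n p q) \<le> same_block Q"
    using le by (simp add: atoms_below_def pair_partition_atom)
  moreover have "same_block (pair_partition n p q) p q"
    using idx by (auto simp: atom_index_def same_block_pair_partition)
  ultimately show "same_block Q p q"
    by blast
qed

lemma atom_below_same_block:
  assumes "atom_index n i j" "(pair_partition n i j, P) \<in> (good_steps n)\<^sup>*"
  shows "same_block P i j"
  using good_path_le[OF assms(2)] assms(1) same_block_pair_partition[of i j n i j]
  by (auto simp: atom_index_def)

lemma attachedE:
  assumes n: "n \<ge> 2" and P: "on_good_chain n P" and "same_block P n (Suc n)"
  obtains d where "d \<in> {1..<n}" "same_block P d (Suc n)" "spoke n d \<in> atoms_below n P"
proof -
  obtain d where d: "d < n" "same_block P d (Suc n)"
    using assms by (auto simp: on_good_chain_iff)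
  moreover have "d \<ge> 1"
    using same_block_mem[OF NC_partition[OF on_good_chain_NC[OF P]] d(2)] by simp
  ultimately show ?thesis
    using that[of d] spoke_atom[OF n] spoke_le_iff[OF n P] by (auto simp: atoms_below_def)
qed

text \<open>
  The only ambiguity is whether \<open>n\<close> is attached to a block \<open>{b, n + 1}\<close>, as the atoms
  \<open>{b, n}\<close> and \<open>{n, n + 1}\<close> do not lie below the partition with block \<open>{b, n, n + 1}\<close>.
\<close>

lemma atoms_below_eq_imp:
  assumes n: "n \<ge> 2" and P: "on_good_chain n P" and Q: "on_good_chain n Q"
    and eq: "atoms_below n P = atoms_below n Q"
  shows "P = Q \<or> (P, Q) \<in> (good_steps n)\<^sup>* \<or> (Q, P) \<in> (good_steps n)\<^sup>*"
proof -
  have detached: "same_block P \<le> same_block Q"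
    if P: "on_good_chain n P" and Q: "on_good_chain n Q" and "atoms_below n P = atoms_below n Q"
      and "\<not> same_block P n (Suc n)" for P Q
  proof (rule same_block_le_if_atoms_below[OF n P])
    fix e
    assume "e \<in> atoms_below n P"
    then have "e \<in> atoms_below n Q"
      using that by simp
    then show "same_block e \<le> same_block Q"
      by (auto simp: atoms_below_def dest: good_path_le)
  qed (use that on_good_chain_NC in auto)
  have attached: "same_block P \<le> same_block Q"
    if P: "on_good_chain n P" and Q: "on_good_chain n Q" and eq: "atoms_below n P = atoms_below n Q"
      and nP: "same_block P n (Suc n)" and nQ: "same_block Q n (Suc n)" for P Q
  proof (rule same_block_leI)
    show NC: "P \<in> NC (Suc n)" "Q \<in> NC (Suc n)"
      using P Q on_good_chain_NC by auto
    \<comment> \<open>For atoms with \<open>j \<noteq> n\<close>, lying below is the same as being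
      joined. Pairs ending in \<open>n\<close> are reached through \<open>Suc n\<close>, which both
      partitions join to \<open>n\<close>.\<close>
    have transfer: "same_block Q i j" if "atom_index n i j" "same_block P i j" "j \<noteq> n" for i j
    proof -
      have "pair_partition n i j \<in> atoms_below n P"
        using that atom_le_iff[OF n P that(1)] by (auto simp: atoms_below_def pair_partition_atom)
      then have "pair_partition n i j \<in> atoms_below n Q"
        unfolding eq .
      then show ?thesis
        by (intro atom_below_same_block[OF that(1)]) (simp add: atoms_below_def)
    qed
    note trP = same_block_trans[OF NC_partition[OF NC(1)]] and syP = same_block_sym[of P]
    note trQ = same_block_trans[OF NC_partition[OF NC(2)]] and syQ = same_block_sym[of Q]
    fix p q
    assume pq: "1 \<le> p" "p < q" "q \<le> Suc n" "same_block P p q"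
    have spoke: "same_block Q p (Suc n)" if "p < n" "same_block P p (Suc n)"
      using that pq by (intro transfer) (auto simp: atom_index_def)
    consider "q < n" | "q = n" | "p = n" "q = Suc n" | "q = Suc n" "p < n"
      using pq by linarith
    then show "same_block Q p q"
    proof cases
      case 1
      then show ?thesis
        using pq by (intro transfer) (auto simp: atom_index_def)
    next
      case 2
      then have "same_block Q p (Suc n)"
        using pq nP trP by (intro spoke) auto
      then show ?thesis
        using 2 nQ trQ syQ by blast
    next
      case 3
      then show ?thesis
        using nQ by simp
    next
      case 4
      then show ?thesis
        using pq spoke by simp
    qed
  qed
  \<comment> \<open>Here \<open>Q\<close> refines \<open>P\<close> by \<open>detached\<close>, and a
    spoke below \<open>P\<close> is also below \<open>Q\<close>, so \<open>Suc n\<close> is not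
    alone in \<open>Q\<close> and a good path exists.\<close>
  have mixed: "(Q, P) \<in> (good_steps n)\<^sup>*"
    if P: "on_good_chain n P" and Q: "on_good_chain n Q" and eq: "atoms_below n P = atoms_below n Q"
      and nP: "same_block P n (Suc n)" and nQ: "\<not> same_block Q n (Suc n)" for P Q
  proof (rule good_pathI)
    obtain d where d: "d \<in> {1..<n}" "spoke n d \<in> atoms_below n Q"
      using attachedE[OF n P nP] eq by metis
    then have "same_block Q d (Suc n)"
      using spoke_le_iff[OF n Q d(1)] by (simp add: atoms_below_def)
    then show "\<exists>d\<le>n. same_block Q d (Suc n)"
      using d by (intro exI[of _ d]) auto
  qed (use detached[OF Q P] P Q eq nQ on_good_chain_NC in auto)
  have NC: "P \<in> NC (Suc n)" "Q \<in> NC (Suc n)"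
    using P Q on_good_chain_NC by auto
  show ?thesis
  proof (cases "same_block P n (Suc n) = same_block Q n (Suc n)")
    case True
    then have "same_block P \<le> same_block Q" "same_block Q \<le> same_block P"
      using detached[OF P Q eq] detached[OF Q P eq[symmetric]]
        attached[OF P Q eq] attached[OF Q P eq[symmetric]] by blast+
    then show ?thesis
      using NC NC_eqI order_antisym by blast
  next
    case False
    then show ?thesis
      using mixed[OF P Q eq] mixed[OF Q P eq[symmetric]] by blast
  qed
qed

section \<open>Recognising spokes, and the atoms that meet them, from the order\<close>

text \<open>For the converse direction: if \<open>P\<close> joins \<open>n\<close> and
  \<open>Suc n\<close>, it is above a spoke, which must be \<open>e\<close>. If not,
  \<open>P\<close> is the join of its atoms, hence equal to \<open>e\<close>.\<close>

lemma spokes_iff: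
  assumes n: "n \<ge> 2"
  shows "e \<in> spokes n \<longleftrightarrow> e \<in> atoms n \<and> (\<exists>P. on_good_chain n P \<and> P \<noteq> e \<and> atoms_below n P = {e})"
proof
  assume e: "e \<in> spokes n"
  then obtain a where a: "a \<in> {1..<n}" "e = spoke n a"
    by (auto simp: spokes_def)
  define P where "P = kernel_partition (Suc n) (id(n := a, Suc n := a))"
  have "P \<in> NC (Suc n)"
    unfolding P_def using a by (intro kernel_partition_NC) (auto split: if_splits)
  then have P: "on_good_chain n P"
    using a n by (auto simp: on_good_chain_iff P_def intro!: exI[of _ a])
  have "same_block P n (Suc n)" "\<not> same_block e n (Suc n)"
    using a by (auto simp: P_def spoke_def same_block_pair_partition)
  then have "P \<noteq> e"
    by blast
  moreover have "atoms_below n P = {e}"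
  proof
    show "{e} \<subseteq> atoms_below n P"
    proof -
      have "same_block P a (Suc n)"
        using a by (auto simp: P_def)
      then show ?thesis
        using a spoke_atom[OF n] spoke_le_iff[OF n P] by (simp add: atoms_below_def)
    qed
    show "atoms_below n P \<subseteq> {e}"
    proof
      fix x
      assume x: "x \<in> atoms_below n P"
      then obtain i j where ij: "x = pair_partition n i j" "atom_index n i j"
        by (auto simp: atoms_below_def atoms_def)
      have "(pair_partition n i j, P) \<in> (good_steps n)\<^sup>*"
        using x ij(1) by (simp add: atoms_below_def)
      then have le: "same_block P i j" "j = n \<Longrightarrow> \<exists>d<i. same_block P d (Suc n)"
        using \<open>same_block P n (Suc n)\<close> unfolding atom_le_iff[OF n P ij(2)] by blast+
      have P_iff: "same_block P p q \<longleftrightarrow> p = a \<and> (q = n \<or> q = Suc n) \<or> p = n \<and> q = Suc n"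
        if "1 \<le> p" "p < q" "q \<le> Suc n" for p q
        using that a by (auto simp: P_def)
      have "i < j" "1 \<le> i" "j \<le> Suc n" "(i, j) \<noteq> (n, Suc n)"
        using ij(2) by (auto simp: atom_index_def)
      \<comment> \<open>The pair \<open>a\<close>, \<open>n\<close> is joined in \<open>P\<close>,
        but \<open>a\<close> is the least element of its block, so the extra condition of
        \<open>atom_le_iff\<close> fails.\<close>
      moreover have "j \<noteq> n"
      proof
        assume "j = n"
        then have "i = a"
          using le(1) P_iff[of i j] calculation by auto
        obtain d where d: "d < i" "same_block P d (Suc n)"
          using le(2) \<open>j = n\<close> by blast
        moreover have "1 \<le> d"
          using same_block_mem[OF NC_partition[OF on_good_chain_NC[OF P]] d(2)] by simp
        ultimately show False
          using P_iff[of d "Suc n"] \<open>i = a\<close> a by auto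
      qed
      ultimately have "i = a \<and> j = Suc n"
        using le(1) P_iff[of i j] by auto
      then show "x \<in> {e}"
        using ij a by (simp add: spoke_def)
    qed
  qed
  ultimately show "e \<in> atoms n \<and> (\<exists>P. on_good_chain n P \<and> P \<noteq> e \<and> atoms_below n P = {e})"
    using e spokes_subset[OF n] P by blast
next
  assume "e \<in> atoms n \<and> (\<exists>P. on_good_chain n P \<and> P \<noteq> e \<and> atoms_below n P = {e})"
  then obtain P where e: "e \<in> atoms n" and P: "on_good_chain n P" "P \<noteq> e" "atoms_below n P = {e}"
    by blast
  show "e \<in> spokes n"
  proof (rule ccontr)
    assume no_spoke: "e \<notin> spokes n"
    have "\<not> same_block P n (Suc n)"
    proof
      assume "same_block P n (Suc n)"
      then obtain d where "d \<in> {1..<n}" "spoke n d \<in> atoms_below n P"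
        using attachedE[OF n P(1)] by metis
      then show False
        using P(3) no_spoke spoke_mem by auto
    qed
    then have "same_block P \<le> same_block e"
      using P e atoms_on_good_chain[OF n e] on_good_chain_NC
      by (intro same_block_le_if_atoms_below[OF n P(1)]) auto
    moreover have "e \<in> atoms_below n P"
      using P(3) by simp
    then have "same_block e \<le> same_block P"
      by (intro good_path_le[of _ _ n]) (simp add: atoms_below_def)
    ultimately show False
      using P(1,2) atoms_on_good_chain[OF n e] on_good_chain_NC NC_eqI by (metis order_antisym)
  qed
qed

text \<open>Stated in terms of order, atoms and spokes only, hence invariant under automorphisms. By
  \<open>separated_iff\<close> it says, for a spoke and an atom that is no spoke, that the two
  chords do not meet.\<close>

definition separated :: "nat \<Rightarrow> nat set set \<Rightarrow> nat set set \<Rightarrow> bool" where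
  "separated n s e \<longleftrightarrow> (\<exists>P. on_good_chain n P \<and> (s, P) \<in> (good_steps n)\<^sup>* \<and>
     (e, P) \<in> (good_steps n)\<^sup>* \<and> atoms_below n P \<inter> spokes n = {s})"

text \<open>If the chords meet, every upper bound joins an endpoint of the pair other than
  \<open>b\<close> to \<open>Suc n\<close>, which produces a second spoke. If they do not, the
  partition joining just the two pairs is noncrossing and lies above one spoke only.\<close>

lemma separated_iff:
  assumes n: "n \<ge> 2" and b: "b \<in> {1..<n}" and ij: "atom_index n i j" "j \<le> n"
  shows "separated n (spoke n b) (pair_partition n i j) \<longleftrightarrow> \<not> (i \<le> b \<and> b \<le> j)"
proof
  assume "separated n (spoke n b) (pair_partition n i j)"
  then obtain P where P: "on_good_chain n P" and bP: "(spoke n b, P) \<in> (good_steps n)\<^sup>*"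
    and ijP: "(pair_partition n i j, P) \<in> (good_steps n)\<^sup>*"
    and only: "atoms_below n P \<inter> spokes n = {spoke n b}"
    by (auto simp: separated_def)
  have NC: "P \<in> NC (Suc n)"
    using P by (rule on_good_chain_NC)
  note tr = same_block_trans[OF NC_partition[OF NC]] and sy = same_block_sym[of P]
  have b': "same_block P b (Suc n)"
    using bP spoke_le_iff[OF n P b] by simp
  have ij': "same_block P i j" "j = n \<and> same_block P n (Suc n) \<longrightarrow> (\<exists>d<i. same_block P d (Suc n))"
    using ijP atom_le_iff[OF n P ij(1)] by auto
  have unique: "c = b" if "c < n" "same_block P c (Suc n)" for c
  proof -
    have c: "c \<in> {1..<n}"
      using that same_block_mem[OF NC_partition[OF NC] that(2)] by simp
    then have "spoke n c \<in> atoms_below n P \<inter> spokes n"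
      using that by (simp add: atoms_below_def spoke_le_iff[OF n P] spoke_atom[OF n] spoke_mem)
    then show ?thesis
      using only spoke_eq_iff[OF c b] by simp
  qed
  show "\<not> (i \<le> b \<and> b \<le> j)"
  proof
    assume "i \<le> b \<and> b \<le> j"
    then consider "b = i" "j < n" | "b = i" "j = n" | "b = j" | "i < b" "b < j"
      using ij(2) by linarith
    then show False
    proof cases
      case 1
      then have "same_block P j (Suc n)"
        using ij' b' tr sy by blast
      then show False
        using unique[of j] 1 ij(1) by (simp add: atom_index_def)
    next
      \<comment> \<open>The endpoint \<open>n\<close> carries no spoke; the second spoke is the
        \<open>d < i\<close> from the extra condition of \<open>atom_le_iff\<close>.\<close>
      case 2
      then have "same_block P n (Suc n)"
        using ij' b' tr sy by blast
      then show False
        using ij'(2) 2 unique ij(1) b by (metis atLeastLessThan_iff less_irrefl less_trans)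
    next
      case 3
      then have "same_block P i (Suc n)"
        using ij' b' tr by blast
      then show False
        using unique[of i] 3 b ij(1) by (simp add: atom_index_def)
    next
      case 4
      then have "same_block P i b"
        using NC_noncrossing[OF NC _ _ _ ij'(1) b'] ij by simp
      then have "same_block P i (Suc n)"
        using b' tr by blast
      then show False
        using unique[of i] 4 b by simp
    qed
  qed
next
  assume sep: "\<not> (i \<le> b \<and> b \<le> j)"
  define P where "P = kernel_partition (Suc n) (id(j := i, Suc n := b))"
  have idx: "1 \<le> i" "i < j" "(i, j) \<noteq> (1, n)"
    using ij(1) by (auto simp: atom_index_def)
  have "P \<in> NC (Suc n)"
    unfolding P_def using sep idx b ij(2) by (intro kernel_partition_NC) (auto split: if_splits)
  moreover have nn: "\<not> same_block P n (Suc n)"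
    using sep idx b ij(2) by (auto simp: P_def)
  moreover have bP: "same_block P b (Suc n)"
    using sep idx b ij(2) by (auto simp: P_def)
  ultimately have P: "on_good_chain n P"
    using n b by (auto simp: on_good_chain_iff intro!: exI[of _ b])
  have "(spoke n b, P) \<in> (good_steps n)\<^sup>*"
    using bP spoke_le_iff[OF n P b] by simp
  moreover have "(pair_partition n i j, P) \<in> (good_steps n)\<^sup>*"
    unfolding atom_le_iff[OF n P ij(1)] using nn idx ij(2) by (auto simp: P_def)
  moreover have "atoms_below n P \<inter> spokes n = {spoke n b}"
  proof -
    have "c = b" if "c \<in> {1..<n}" "same_block P c (Suc n)" for c
      using that sep idx ij(2) by (auto simp: P_def split: if_splits)
    then have "{c \<in> {1..<n}. same_block P c (Suc n)} = {b}"
      using b bP by blast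
    moreover have "spoke n c \<in> atoms_below n P \<longleftrightarrow> same_block P c (Suc n)" if "c \<in> {1..<n}" for c
      using that spoke_atom[OF n] spoke_le_iff[OF n P] by (simp add: atoms_below_def)
    then have "atoms_below n P \<inter> spokes n = spoke n ` {c \<in> {1..<n}. same_block P c (Suc n)}"
      unfolding spokes_def by blast
    ultimately show ?thesis
      by simp
  qed
  ultimately show "separated n (spoke n b) (pair_partition n i j)"
    unfolding separated_def using P by blast
qed

definition hit_spokes :: "nat \<Rightarrow> nat set set \<Rightarrow> nat set set set" where
  "hit_spokes n e = {s \<in> spokes n. \<not> separated n s e}"

text \<open>The cap \<open>n - 1\<close> is there because \<open>(n, Suc n)\<close> is not an atom,
  so no spoke ends at \<open>n\<close>.\<close>

lemma hit_spokes_eq: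
  assumes "n \<ge> 2" "atom_index n i j" "j \<le> n"
  shows "hit_spokes n (pair_partition n i j) = spoke n ` {i..min j (n - 1)}"
proof -
  have "{i..min j (n - 1)} = {b \<in> {1..<n}. i \<le> b \<and> b \<le> j}"
    using assms by (auto simp: atom_index_def)
  moreover have "hit_spokes n (pair_partition n i j) = spoke n ` {b \<in> {1..<n}. i \<le> b \<and> b \<le> j}"
    using separated_iff[OF assms(1) _ assms(2,3)] by (auto simp: hit_spokes_def spokes_def)
  ultimately show ?thesis
    by simp
qed

lemma card_hit_spokes:
  assumes "n \<ge> 2" "atom_index n i j" "j \<le> n"
  shows "card (hit_spokes n (pair_partition n i j)) = Suc (min j (n - 1)) - i"
  unfolding hit_spokes_eq[OF assms] using assms
  by (subst card_image) (auto simp: inj_on_def spoke_eq_iff atom_index_def)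

section \<open>Automorphisms\<close>

text \<open>A locale, so that results on \<open>f\<close> can be instantiated with its inverse, as
  \<open>not_strictly_decreasing\<close> does.\<close>

locale good_chain_automorphism =
  fixes n :: nat and f :: "nat set set \<Rightarrow> nat set set"
  assumes n: "n \<ge> 2"
    and bij: "bij_betw f {P. on_good_chain n P} {P. on_good_chain n P}"
    and le_iff: "\<And>P Q. on_good_chain n P \<Longrightarrow> on_good_chain n Q \<Longrightarrow>
      (f P, f Q) \<in> (good_steps n)\<^sup>* \<longleftrightarrow> (P, Q) \<in> (good_steps n)\<^sup>*"
begin

lemma closed: "on_good_chain n P \<Longrightarrow> on_good_chain n (f P)"
  using bij by (auto simp: bij_betw_def)

lemma inj: "on_good_chain n P \<Longrightarrow> on_good_chain n Q \<Longrightarrow> f P = f Q \<longleftrightarrow> P = Q"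
  using bij by (auto simp: bij_betw_def inj_on_def)

lemma surjE:
  assumes "on_good_chain n Q"
  obtains P where "on_good_chain n P" "Q = f P"
  using assms bij unfolding bij_betw_def by (metis imageE mem_Collect_eq)

text \<open>Reindexes existential statements over the poset along \<open>f\<close>, so that the
  characterisations of spokes and of \<open>separated\<close> transfer.\<close>

lemma ex_image: "(\<exists>Q. on_good_chain n Q \<and> R Q) \<longleftrightarrow> (\<exists>P. on_good_chain n P \<and> R (f P))"
proof
  assume "\<exists>Q. on_good_chain n Q \<and> R Q"
  then obtain Q where Q: "on_good_chain n Q" "R Q"
    by blast
  from Q(1) obtain P where "on_good_chain n P" "Q = f P"
    by (rule surjE)
  with Q(2) show "\<exists>P. on_good_chain n P \<and> R (f P)"
    by blast
next
  assume "\<exists>P. on_good_chain n P \<and> R (f P)"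
  then show "\<exists>Q. on_good_chain n Q \<and> R Q"
    using closed by blast
qed

lemma bot_fixed: "f (NC_bot (Suc n)) = NC_bot (Suc n)"
proof -
  let ?b = "NC_bot (Suc n)"
  have b: "on_good_chain n ?b"
    using n by (rule NC_bot_on_good_chain)
  have least: "(?b, P) \<in> (good_steps n)\<^sup>*" if "on_good_chain n P" for P
    using that by (simp add: on_good_chain_def)
  obtain P where P: "on_good_chain n P" "?b = f P"
    using b by (rule surjE)
  then have "(f ?b, ?b) \<in> (good_steps n)\<^sup>*"
    using le_iff[OF b P(1)] least by simp
  then show ?thesis
    using least[OF closed[OF b]] good_path_antisym closed[OF b] b on_good_chain_NC by metis
qed

lemma atom_iff:
  assumes P: "on_good_chain n P"
  shows "f P \<in> atoms n \<longleftrightarrow> P \<in> atoms n"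
proof -
  let ?b = "NC_bot (Suc n)"
  have b: "on_good_chain n ?b"
    using n by (rule NC_bot_on_good_chain)
  have "f P \<noteq> ?b \<longleftrightarrow> P \<noteq> ?b"
    using inj[OF P b] bot_fixed by simp
  moreover have "(\<forall>Q. on_good_chain n Q \<and> (Q, f P) \<in> (good_steps n)\<^sup>* \<longrightarrow> Q = ?b \<or> Q = f P) \<longleftrightarrow>
      (\<forall>Q. on_good_chain n Q \<and> (Q, P) \<in> (good_steps n)\<^sup>* \<longrightarrow> Q = ?b \<or> Q = P)" (is "?l \<longleftrightarrow> ?r")
  proof
    assume ?l
    show ?r
    proof (intro allI impI)
      fix Q
      assume Q: "on_good_chain n Q \<and> (Q, P) \<in> (good_steps n)\<^sup>*"
      then have "on_good_chain n (f Q)" "(f Q, f P) \<in> (good_steps n)\<^sup>*"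
        using closed le_iff P by auto
      then have "f Q = ?b \<or> f Q = f P"
        using \<open>?l\<close> by blast
      then show "Q = ?b \<or> Q = P"
        using Q inj P b bot_fixed by metis
    qed
  next
    assume ?r
    show ?l
    proof (intro allI impI)
      fix Q
      assume Q: "on_good_chain n Q \<and> (Q, f P) \<in> (good_steps n)\<^sup>*"
      then obtain R where R: "on_good_chain n R" "Q = f R"
        using surjE by blast
      then have "(R, P) \<in> (good_steps n)\<^sup>*"
        using le_iff[OF R(1) P] Q by simp
      then have "R = ?b \<or> R = P"
        using \<open>?r\<close> R(1) by blast
      then show "Q = ?b \<or> Q = f P"
        using R bot_fixed by auto
    qed
  qed
  ultimately show ?thesis
    unfolding atoms_iff_minimal[OF n] using P closed[OF P] by (simp only: simp_thms)
qed

lemma atom_surjE: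
  assumes "e \<in> atoms n"
  obtains a where "a \<in> atoms n" "e = f a"
proof -
  obtain a where "on_good_chain n a" "e = f a"
    using surjE[OF atoms_on_good_chain[OF n assms]] by blast
  then show ?thesis
    using that assms atom_iff by simp
qed

lemma atoms_below_image:
  assumes P: "on_good_chain n P"
  shows "atoms_below n (f P) = f ` atoms_below n P"
proof
  show "f ` atoms_below n P \<subseteq> atoms_below n (f P)"
    using P by (auto simp: atoms_below_def atom_iff le_iff atoms_on_good_chain[OF n])
  show "atoms_below n (f P) \<subseteq> f ` atoms_below n P"
  proof
    fix e
    assume e: "e \<in> atoms_below n (f P)"
    then obtain a where "a \<in> atoms n" "e = f a"
      by (auto simp: atoms_below_def elim: atom_surjE)
    then show "e \<in> f ` atoms_below n P"
      using e P by (auto simp: atoms_below_def le_iff atoms_on_good_chain[OF n])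
  qed
qed

lemma inj_on_atoms: "inj_on f (atoms n)"
  using inj atoms_on_good_chain[OF n] by (auto simp: inj_on_def)

lemma spoke_image_iff:
  assumes e: "e \<in> atoms n"
  shows "f e \<in> spokes n \<longleftrightarrow> e \<in> spokes n"
proof -
  have good: "on_good_chain n e"
    using n e by (rule atoms_on_good_chain)
  have key: "f P \<noteq> f e \<and> atoms_below n (f P) = {f e} \<longleftrightarrow> P \<noteq> e \<and> atoms_below n P = {e}"
    if "on_good_chain n P" for P
  proof -
    have "f ` atoms_below n P = f ` {e} \<longleftrightarrow> atoms_below n P = {e}"
      using inj_on_atoms by (rule inj_on_image_eq_iff) (use e in \<open>auto simp: atoms_below_def\<close>)
    then show ?thesis
      unfolding atoms_below_image[OF that] inj[OF that good] by (simp only: image_insert image_empty)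
  qed
  show ?thesis
    unfolding spokes_iff[OF n] atom_iff[OF good]
      ex_image[of "\<lambda>P. P \<noteq> f e \<and> atoms_below n P = {f e}"]
    by (simp only: key cong: conj_cong)
qed

lemma separated_image:
  assumes s: "s \<in> spokes n" and e: "e \<in> atoms n"
  shows "separated n (f s) (f e) \<longleftrightarrow> separated n s e"
proof -
  have sa: "s \<in> atoms n"
    using s spokes_subset[OF n] by blast
  note good = atoms_on_good_chain[OF n sa] atoms_on_good_chain[OF n e]
  have key: "(f s, f P) \<in> (good_steps n)\<^sup>* \<and> (f e, f P) \<in> (good_steps n)\<^sup>* \<and>
      atoms_below n (f P) \<inter> spokes n = {f s} \<longleftrightarrow>
      (s, P) \<in> (good_steps n)\<^sup>* \<and> (e, P) \<in> (good_steps n)\<^sup>* \<and> atoms_below n P \<inter> spokes n = {s}"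
    if P: "on_good_chain n P" for P
  proof -
    have sub: "atoms_below n P \<subseteq> atoms n"
      by (auto simp: atoms_below_def)
    have "atoms_below n (f P) \<inter> spokes n = f ` (atoms_below n P \<inter> spokes n)"
      unfolding atoms_below_image[OF P] using sub spoke_image_iff by blast
    moreover have "f ` (atoms_below n P \<inter> spokes n) = f ` {s} \<longleftrightarrow> atoms_below n P \<inter> spokes n = {s}"
      using inj_on_atoms by (rule inj_on_image_eq_iff) (use sub sa in auto)
    ultimately have "atoms_below n (f P) \<inter> spokes n = {f s} \<longleftrightarrow> atoms_below n P \<inter> spokes n = {s}"
      by (simp only: image_insert image_empty)
    then show ?thesis
      by (simp only: le_iff[OF good(1) P] le_iff[OF good(2) P])
  qed
  show ?thesis
    unfolding separated_def ex_image[of "\<lambda>P. (f s, P) \<in> (good_steps n)\<^sup>* \<and>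
      (f e, P) \<in> (good_steps n)\<^sup>* \<and> atoms_below n P \<inter> spokes n = {f s}"]
    by (simp only: key cong: conj_cong)
qed

lemma hit_spokes_image:
  assumes e: "e \<in> atoms n"
  shows "hit_spokes n (f e) = f ` hit_spokes n e"
proof
  show "f ` hit_spokes n e \<subseteq> hit_spokes n (f e)"
    using e spokes_subset[OF n] by (auto simp: hit_spokes_def separated_image spoke_image_iff)
  show "hit_spokes n (f e) \<subseteq> f ` hit_spokes n e"
  proof
    fix s
    assume s: "s \<in> hit_spokes n (f e)"
    then obtain a where a: "a \<in> atoms n" "s = f a"
      using spokes_subset[OF n] by (auto simp: hit_spokes_def elim: atom_surjE)
    then have "a \<in> spokes n"
      using s spoke_image_iff by (simp add: hit_spokes_def)
    then show "s \<in> f ` hit_spokes n e"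
      using s a e by (auto simp: hit_spokes_def separated_image)
  qed
qed

lemma card_hit_spokes_image:
  assumes e: "e \<in> atoms n"
  shows "card (hit_spokes n (f e)) = card (hit_spokes n e)"
proof -
  have "inj_on f (hit_spokes n e)"
    using inj_on_atoms by (rule inj_on_subset) (use spokes_subset[OF n] in \<open>auto simp: hit_spokes_def\<close>)
  then show ?thesis
    by (simp add: hit_spokes_image[OF e] card_image)
qed

lemma non_spoke_image:
  assumes "atom_index n i j" "j \<le> n"
  obtains i' j' where "f (pair_partition n i j) = pair_partition n i' j'" "atom_index n i' j'" "j' \<le> n"
proof (rule non_spokeE)
  have e: "pair_partition n i j \<in> atoms n" "pair_partition n i j \<notin> spokes n"
    using assms by (auto simp: pair_partition_atom atom_mem_spokes_iff)
  then show "f (pair_partition n i j) \<in> atoms n"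
    using atom_iff atoms_on_good_chain[OF n] by blast
  show "f (pair_partition n i j) \<notin> spokes n"
    using e spoke_image_iff by blast
qed (use that in blast)

lemma spoke_image:
  assumes "b \<in> {1..<n}"
  obtains c where "c \<in> {1..<n}" "f (spoke n b) = spoke n c"
proof -
  have "f (spoke n b) \<in> spokes n"
    using assms spoke_image_iff[OF spoke_atom[OF n]] spoke_mem by simp
  then show ?thesis
    using that by (auto simp: spokes_def)
qed

section \<open>Spokes and atoms are fixed\<close>

text \<open>The atom \<open>(n - 1, n)\<close> meets only the last spoke, so its image also meets a
  single one, and only the last spoke can be met alone. For \<open>n = 2\<close> that pair is the
  excluded \<open>(1, n)\<close>, but then there is just one spoke.\<close>

lemma last_spoke_fixed: "f (spoke n (n - 1)) = spoke n (n - 1)"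
proof (cases "n = 2")
  case True
  then have "1 \<in> {1..<n}"
    by simp
  then obtain c where c: "c \<in> {1..<n}" "f (spoke n 1) = spoke n c"
    by (rule spoke_image)
  then have "c = 1"
    using True by simp
  then show ?thesis
    using True c by simp
next
  case False
  then have idx: "atom_index n (n - 1) n"
    using n by (auto simp: atom_index_def)
  obtain i j where ij: "f (pair_partition n (n - 1) n) = pair_partition n i j" "atom_index n i j" "j \<le> n"
    using non_spoke_image[OF idx] by blast
  have "spoke n ` {i..min j (n - 1)} = hit_spokes n (f (pair_partition n (n - 1) n))"
    using hit_spokes_eq[OF n ij(2,3)] ij(1) by simp
  also have "\<dots> = f ` spoke n ` {n - 1..min n (n - 1)}"
    using hit_spokes_image[OF pair_partition_atom[OF idx]] hit_spokes_eq[OF n idx] by simp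
  also have "\<dots> = {f (spoke n (n - 1))}"
    by simp
  finally have eq: "spoke n ` {i..min j (n - 1)} = {f (spoke n (n - 1))}" .
  have bounds: "1 \<le> i" "i < j" "i \<le> n - 1" "min j (n - 1) \<ge> 1" "min j (n - 1) < n" "i \<le> min j (n - 1)"
    using ij(2,3) n by (auto simp: atom_index_def)
  then have i: "spoke n i = f (spoke n (n - 1))" and "spoke n (min j (n - 1)) = f (spoke n (n - 1))"
    using eq by auto
  then have "spoke n i = spoke n (min j (n - 1))"
    by simp
  then have "i = min j (n - 1)"
    using bounds n by (subst (asm) spoke_eq_iff) auto
  \<comment> \<open>As \<open>i < j\<close>, the minimum cannot be \<open>j\<close>.\<close>
  then have "i = n - 1"
    using bounds by auto
  with i show ?thesis
    by simp
qed

text \<open>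
  An upper bound of two spokes has both endpoints in the block of \<open>n + 1\<close>, hence is above the
  atom joining them.
\<close>

lemma pair_image:
  assumes ij: "1 \<le> i" "i < j" "j < n" and i': "i' \<in> {1..<n}" "f (spoke n i) = spoke n i'"
    and j': "j' \<in> {1..<n}" "f (spoke n j) = spoke n j'"
  shows "f (pair_partition n i j) = pair_partition n (min i' j') (max i' j')"
proof -
  have idx: "atom_index n i j"
    using ij by (auto simp: atom_index_def)
  obtain x y where xy: "f (pair_partition n i j) = pair_partition n x y" "atom_index n x y" "y \<le> n"
    using non_spoke_image[OF idx] ij by (metis less_imp_le)
  \<comment> \<open>The block \<open>{i', j', Suc n}\<close> is the only nontrivial one of
    \<open>Q\<close>, so an atom below \<open>Q\<close> that is no spoke must join \<open>i'\<close>
    and \<open>j'\<close>.\<close>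
  define Q where "Q = kernel_partition (Suc n) (id(j' := i', Suc n := i'))"
  have "Q \<in> NC (Suc n)"
    unfolding Q_def using i' j' by (intro kernel_partition_NC) (auto split: if_splits)
  moreover have "\<not> same_block Q n (Suc n)"
    using i' j' by (auto simp: Q_def)
  moreover have Qi: "same_block Q i' (Suc n)" and Qj: "same_block Q j' (Suc n)"
    using i' j' by (auto simp: Q_def)
  ultimately have Q: "on_good_chain n Q"
    using n i' by (auto simp: on_good_chain_iff intro!: exI[of _ i'])
  obtain P where P: "on_good_chain n P" "Q = f P"
    using Q by (rule surjE)
  have i: "i \<in> {1..<n}" and j: "j \<in> {1..<n}"
    using ij by auto
  have "(f (spoke n i), f P) \<in> (good_steps n)\<^sup>*" "(f (spoke n j), f P) \<in> (good_steps n)\<^sup>*"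
    using Qi Qj i' j' P(2) spoke_le_iff[OF n Q] by auto
  then have "same_block P i (Suc n)" "same_block P j (Suc n)"
    using le_iff atoms_on_good_chain[OF n spoke_atom[OF n]] P(1) i j spoke_le_iff[OF n P(1)] by metis+
  then have "same_block P i j"
    using same_block_trans[OF NC_partition[OF on_good_chain_NC[OF P(1)]]] same_block_sym by metis
  then have "(pair_partition n i j, P) \<in> (good_steps n)\<^sup>*"
    using ij by (simp add: atom_le_iff[OF n P(1) idx])
  then have "(pair_partition n x y, Q) \<in> (good_steps n)\<^sup>*"
    using le_iff[OF atom_on_good_chain[OF n idx] P(1)] xy(1) P(2) by simp
  then have "same_block Q x y"
    using xy(2) by (intro atom_below_same_block)
  then have "x = min i' j' \<and> y = max i' j'"
    using xy(2,3) i' j' by (auto simp: Q_def atom_index_def split: if_splits)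
  with xy(1) show ?thesis
    by simp
qed

text \<open>The last spoke is fixed, so by \<open>pair_image\<close> the atom
  \<open>(b, n - 1)\<close> goes to \<open>(c, n - 1)\<close>. These meet \<open>n - b\<close> and
  \<open>n - c\<close> spokes.\<close>

lemma spoke_fixed:
  assumes b: "b \<in> {1..<n}"
  shows "f (spoke n b) = spoke n b"
proof (cases "b = n - 1")
  case True
  then show ?thesis
    using last_spoke_fixed by simp
next
  case False
  obtain c where c: "c \<in> {1..<n}" "f (spoke n b) = spoke n c"
    using spoke_image[OF b] by blast
  have idx: "atom_index n b (n - 1)"
    using b False by (auto simp: atom_index_def)
  have "c \<noteq> n - 1"
  proof
    assume "c = n - 1"
    then have "f (spoke n b) = f (spoke n (n - 1))"
      using c last_spoke_fixed by simp
    then have "spoke n b = spoke n (n - 1)"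
      using inj_on_atoms spoke_atom[OF n] b n by (auto dest: inj_onD)
    then show False
      using False b n by (subst (asm) spoke_eq_iff) auto
  qed
  then have idx': "atom_index n c (n - 1)"
    using c by (auto simp: atom_index_def)
  have minmax: "min c (n - 1) = c" "max c (n - 1) = n - 1"
    using c by auto
  have "f (pair_partition n b (n - 1)) = pair_partition n (min c (n - 1)) (max c (n - 1))"
    using b c False n last_spoke_fixed by (intro pair_image) auto
  then have "f (pair_partition n b (n - 1)) = pair_partition n c (n - 1)"
    unfolding minmax .
  then have "card (hit_spokes n (pair_partition n c (n - 1))) = card (hit_spokes n (pair_partition n b (n - 1)))"
    using card_hit_spokes_image[OF pair_partition_atom[OF idx]] by simp
  then have "n - c = n - b"
    using card_hit_spokes[OF n idx] card_hit_spokes[OF n idx'] n by simp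
  then have "c = b"
    using b c by auto
  with c show ?thesis
    by simp
qed

text \<open>Pairs below \<open>n\<close> are fixed because their two spokes are. By injectivity a
  pair ending in \<open>n\<close> then goes to one ending in \<open>n\<close>, and the number of
  spokes it meets determines its other endpoint.\<close>

lemma atom_fixed:
  assumes "e \<in> atoms n"
  shows "f e = e"
proof -
  obtain i j where e: "e = pair_partition n i j" and idx: "atom_index n i j"
    using assms by (auto simp: atoms_def)
  have inner: "f (pair_partition n i j) = pair_partition n i j" if "1 \<le> i" "i < j" "j < n" for i j
    using pair_image[of i j i j] spoke_fixed[of i] spoke_fixed[of j] that by auto
  have "j \<le> Suc n"
    using idx by (simp add: atom_index_def)
  then consider "j = Suc n" | "j < n" | "j = n"
    by linarith
  then show ?thesis
  proof cases
    case 1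
    then show ?thesis
      using spoke_fixed[of i] idx e by (auto simp: spoke_def atom_index_def)
  next
    case 2
    then show ?thesis
      using inner idx e by (simp add: atom_index_def)
  next
    case 3
    obtain x y where xy: "f (pair_partition n i j) = pair_partition n x y" "atom_index n x y" "y \<le> n"
      using non_spoke_image[OF idx] 3 by blast
    have "y = n"
    proof (rule ccontr)
      assume "y \<noteq> n"
      then have "f (pair_partition n x y) = f (pair_partition n i j)"
        using inner[of x y] xy by (auto simp: atom_index_def)
      then have "pair_partition n x y = pair_partition n i j"
        using inj_on_atoms xy(2) idx pair_partition_atom by (metis inj_onD)
      then show False
        using xy(2) idx 3 \<open>y \<noteq> n\<close> by (subst (asm) pair_partition_eq_iff) (auto simp: atom_index_def)
    qed
    have "card (hit_spokes n (pair_partition n x y)) = card (hit_spokes n (pair_partition n i j))"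
      using card_hit_spokes_image[OF pair_partition_atom[OF idx]] xy(1) by simp
    then have "n - x = n - i"
      using card_hit_spokes[OF n idx] card_hit_spokes[OF n xy(2,3)] 3 \<open>y = n\<close> n by simp
    then have "x = i"
      using xy(2,3) idx 3 by (auto simp: atom_index_def)
    then show ?thesis
      using xy(1) e 3 \<open>y = n\<close> by simp
  qed
qed

section \<open>From atoms to all elements\<close>

text \<open>
  In a finite poset, no automorphism moves an element strictly up: it would have to map the
  principal ideal bijectively onto a larger one.
\<close>

lemma not_strictly_increasing:
  assumes P: "on_good_chain n P" and le: "(P, f P) \<in> (good_steps n)\<^sup>*"
  shows "f P = P"
proof -
  define D where "D P = {Q. on_good_chain n Q \<and> (Q, P) \<in> (good_steps n)\<^sup>*}" for P
  have fin: "finite (D Q)" for Q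
    by (rule finite_subset[OF _ finite_NC[of "Suc n"]]) (auto simp: D_def on_good_chain_NC)
  have "D (f P) = f ` D P"
  proof
    show "f ` D P \<subseteq> D (f P)"
      using P by (auto simp: D_def closed le_iff)
    show "D (f P) \<subseteq> f ` D P"
    proof
      fix Q
      assume Q: "Q \<in> D (f P)"
      then obtain R where "on_good_chain n R" "Q = f R"
        by (auto simp: D_def elim: surjE)
      then show "Q \<in> f ` D P"
        using Q P by (auto simp: D_def le_iff)
    qed
  qed
  moreover have "inj_on f (D P)"
    using inj by (auto simp: D_def inj_on_def)
  ultimately have "card (D (f P)) = card (D P)"
    by (simp add: card_image)
  moreover have "D P \<subseteq> D (f P)"
    using le by (auto simp: D_def intro: rtrancl_trans)
  ultimately have "D P = D (f P)"
    using fin by (intro card_subset_eq) auto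
  then have "(f P, P) \<in> (good_steps n)\<^sup>*"
    using closed[OF P] by (auto simp: D_def)
  then show ?thesis
    using le P closed[OF P] on_good_chain_NC good_path_antisym by metis
qed

text \<open>The inverse \<open>?g\<close> maps \<open>f P\<close> to \<open>P\<close>, hence moves
  \<open>f P\<close> weakly up, and the increasing case applies to \<open>?g\<close>.\<close>

lemma not_strictly_decreasing:
  assumes P: "on_good_chain n P" and le: "(f P, P) \<in> (good_steps n)\<^sup>*"
  shows "f P = P"
proof -
  let ?g = "inv_into {P. on_good_chain n P} f"
  have g: "on_good_chain n (?g Q)" "f (?g Q) = Q" if "on_good_chain n Q" for Q
    using bij that inv_into_into[of Q f "{P. on_good_chain n P}"] f_inv_into_f[of Q f "{P. on_good_chain n P}"]
    by (auto simp: bij_betw_def)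
  interpret g: good_chain_automorphism n ?g
  proof
    show "bij_betw ?g {P. on_good_chain n P} {P. on_good_chain n P}"
      using bij by (rule bij_betw_inv_into)
    show "(?g P, ?g Q) \<in> (good_steps n)\<^sup>* \<longleftrightarrow> (P, Q) \<in> (good_steps n)\<^sup>*"
      if "on_good_chain n P" "on_good_chain n Q" for P Q
      using le_iff[of "?g P" "?g Q"] g that by simp
  qed (rule n)
  have gf: "?g (f P) = P"
    using g[OF closed[OF P]] inj P by metis
  then show ?thesis
    using g.not_strictly_increasing[OF closed[OF P]] le by simp
qed

lemma fixed:
  assumes P: "on_good_chain n P"
  shows "f P = P"
proof -
  have "f ` atoms_below n P = atoms_below n P"
    using atom_fixed by (force simp: atoms_below_def)
  then have "atoms_below n P = atoms_below n (f P)"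
    using atoms_below_image[OF P] by simp
  then show ?thesis
    using atoms_below_eq_imp[OF n P closed[OF P]] not_strictly_increasing[OF P]
      not_strictly_decreasing[OF P] by metis
qed

end

theorem theorem2p8:
  fixes n :: nat
  assumes "n \<ge> 2"
  defines "S \<equiv> parking_functions_avoiding_max n"
  shows "order_automorphism (pf_poset_elems n S) (pf_poset_le n S) id \<and>
         (\<forall>f. order_automorphism (pf_poset_elems n S) (pf_poset_le n S) f \<longrightarrow>
              (\<forall>x\<in>pf_poset_elems n S. f x = x))"
proof (intro conjI allI impI ballI)
  show "order_automorphism (pf_poset_elems n S) (pf_poset_le n S) id"
    by (simp add: order_automorphism_def)
next
  fix f P
  assume f: "order_automorphism (pf_poset_elems n S) (pf_poset_le n S) f"
    and P: "P \<in> pf_poset_elems n S"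
  have "n \<ge> 1"
    using assms(1) by simp
  note elems = pf_poset_elems_eq[OF this, folded S_def] and le = pf_poset_le_iff[OF this, folded S_def]
  interpret good_chain_automorphism n f
  proof
    show "bij_betw f {P. on_good_chain n P} {P. on_good_chain n P}"
      using f by (simp add: order_automorphism_def elems)
    then have "on_good_chain n (f P)" if "on_good_chain n P" for P
      using that by (auto simp: bij_betw_def)
    then show "(f P, f Q) \<in> (good_steps n)\<^sup>* \<longleftrightarrow> (P, Q) \<in> (good_steps n)\<^sup>*"
      if "on_good_chain n P" "on_good_chain n Q" for P Q
      using f that by (simp add: order_automorphism_def elems le)
  qed (rule assms(1))
  show "f P = P"
    using P by (intro fixed) (simp add: elems)
qed

end
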